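(* Let $n\ge 1$ be an integer and $0<s<1$. If $\varphi\in\mathcal{S}(\mathbb{R}^n\times\mathbb{R})$, then $(\partial_t-\Delta)^s_{\rm right}\varphi\in C^\infty(\mathbb{R}^n\times\mathbb{R})$, and there is a constant $C>0$ (independent of $(x,t)$) such that $$\left|(\partial_t-\Delta)^s_{\rm right}\varphi(x,t)\right|\le\frac{C}{1+|x|^{n+2+2s}+|t|^{\frac n2+1+s}}\qquad\text{for all }(x,t)\in\mathbb{R}^n\times\mathbb{R}.$$
   Context: $\mathcal{S}(\mathbb{R}^n\times\mathbb{R})$ is the space of Schwartz functions. For $\varphi\in\mathcal{S}(\mathbb{R}^n\times\mathbb{R})$, $$(\partial_t-\Delta)^s_{\rm right}\varphi(x,t):=C_{n,s}\int_t^{+\infty}\int_{\mathbb{R}^n}\frac{\varphi(x,t)-\varphi(y,\tau)}{(\tau-t)^{\frac n2+1+s}}\,e^{-\frac{|x-y|^2}{4(\tau-t)}}\,dy\,d\tau,\qquad C_{n,s}=\frac{1}{(4\pi)^{n/2}|\Gamma(-s)|},$$ where the integral in $y$ is taken in the Cauchy principal value sense. Equivalently, without principal value, $$(\partial_t-\Delta)^s_{\rm right}\varphi(x,t)=\frac{C_{n,s}}{2}\int_0^{+\infty}\int_{\mathbb{R}^n}\frac{2\varphi(x,t)-\varphi(x+y,t+\tau)-\varphi(x-y,t+\tau)}{\tau^{\frac n2+1+s}}\,e^{-\frac{|y|^2}{4\tau}}\,dy\,d\tau .$$ *)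

theory Defs
  imports "HOL-Analysis.Analysis"
begin

definition partial_derivative ::
    "'a::euclidean_space \<Rightarrow> ('a \<Rightarrow> 'b::real_normed_vector) \<Rightarrow> 'a \<Rightarrow> 'b"
  where "partial_derivative b f z = vector_derivative (\<lambda>h. f (z + h *\<^sub>R b)) (at 0)"

text \<open>A list of basis vectors plays the role of a multi-index: it records the coordinate
  directions of an iterated partial derivative, the head being differentiated last.\<close>

primrec iterated_partial ::
    "'a list \<Rightarrow> ('a::euclidean_space \<Rightarrow> 'b::real_normed_vector) \<Rightarrow> 'a \<Rightarrow> 'b"
  where
    "iterated_partial [] f = f"
  | "iterated_partial (b # bs) f = partial_derivative b (iterated_partial bs f)"

text \<open>The existence clause is needed because \<^const>\<open>vector_derivative\<close> is a
  total function with an arbitrary value where there is no derivative.\<close>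

definition smooth :: "('a::euclidean_space \<Rightarrow> 'b::real_normed_vector) \<Rightarrow> bool"
  where "smooth f \<longleftrightarrow>
    (\<forall>bs \<in> lists Basis.
       continuous_on UNIV (iterated_partial bs f) \<and>
       (\<forall>b \<in> Basis. \<forall>z. (\<lambda>h::real. iterated_partial bs f (z + h *\<^sub>R b)) differentiable (at 0)))"

definition schwartz :: "('a::euclidean_space \<Rightarrow> 'b::real_normed_vector) \<Rightarrow> bool"
  where "schwartz f \<longleftrightarrow> smooth f \<and>
    (\<forall>(k::nat). \<forall>bs \<in> lists Basis. \<exists>C. \<forall>z. (1 + norm z) ^ k * norm (iterated_partial bs f z) \<le> C)"

text \<open>Cauchy principal value at the point \<open>x\<close>: balls around \<open>x\<close> are removed
  symmetrically and their radius tends to 0.\<close>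

definition pv_integral ::
    "'a::euclidean_space \<Rightarrow> ('a \<Rightarrow> 'b::{banach,second_countable_topology}) \<Rightarrow> 'b"
  where "pv_integral x f = Lim (at_right 0) (\<lambda>\<epsilon>. LINT y : {y. dist x y > \<epsilon>} | lborel. f y)"

definition heat_const :: "nat \<Rightarrow> real \<Rightarrow> real"
  where "heat_const n s = 1 / ((4 * pi) powr (real n / 2) * \<bar>Gamma (- s)\<bar>)"

definition frac_heat_right ::
    "real \<Rightarrow> ((real ^ 'n) \<times> real \<Rightarrow> 'b::{banach,second_countable_topology})
       \<Rightarrow> (real ^ 'n) \<times> real \<Rightarrow> 'b"
  where "frac_heat_right s \<phi> = (\<lambda>(x, t).
    heat_const CARD('n) s *\<^sub>R
      (LINT \<tau> : {t<..} | lborel.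
         pv_integral x (\<lambda>y.
           (exp (- ((norm (x - y))\<^sup>2 / (4 * (\<tau> - t)))) / (\<tau> - t) powr (real CARD('n) / 2 + 1 + s))
             *\<^sub>R (\<phi> (x, t) - \<phi> (y, \<tau>)))))"

end

theory Submission
  imports Defs "HOL-Probability.Sinc_Integral"
begin

text \<open>The principal value is a genuine Lebesgue integral, and averaging over the substitutions
  \<open>y \<mapsto> x + y\<close> and \<open>y \<mapsto> x - y\<close> turns the operator into
  \<open>\<integral>\<integral> k(Z) (2 f(X) - f(X + Z) - f(X + Z'))\<close> over \<open>Z = (y, r)\<close> with \<open>Z' = (- y, r)\<close> and the kernel
  \<open>k(y, r) = r powr (- a) * exp (- |y|^2 / 4 r)\<close>, \<open>a = n / 2 + 1 + s\<close>. The second difference is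
  \<open>O(min 1 (|y|^2 + r))\<close>, which makes the integral absolutely convergent uniformly in \<open>X\<close>, so it
  commutes with partial derivatives and smoothness follows. For the decay put
  \<open>W = 1 + |x|^2 + |t|\<close>. Where \<open>|y|^2 + r \<le> W / 4\<close>, all derivatives of \<open>f\<close> entering the second
  difference are \<open>O(W powr (- a))\<close>; elsewhere \<open>k = O(W powr (- a))\<close> and \<open>f\<close> is integrable.\<close>

section \<open>Partial derivatives and second differences\<close>

text \<open>After the integration in y the kernel leaves \<open>r powr (- 1 - s)\<close>, while
  under it |y|^2 has the size of r. A first difference in space therefore gains only a factor sqrt r
  in absolute value, too weak near r = 0 once s >= 1/2. Second order in space and first order in
  time together gain a full factor r, and 0 < s < 1 makes \<open>min 1 r * r powr (- 1 - s)\<close>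
  integrable at both ends. For this reason the symmetrisation is done at fixed time, where the
  Gaussian alone makes the spatial integral converge, and Fubini is applied only to the symmetrised
  integrand. All kernel bounds trade \<open>exp (- u / 4)\<close>, with u = |y|^2 / r, for negative
  powers of 1 + u. The integrable majorants are products over the coordinates of weights 1 / (1 +
  v^2): by Tonelli their integrals factor, and each coordinate scales by sqrt r.\<close>

lemma iterated_partial_append:
  "iterated_partial (bs @ cs) f = iterated_partial bs (iterated_partial cs f)"
  by (induction bs) auto

lemma smooth_partial_derivative:
  assumes "smooth f" "b \<in> Basis"
  shows "smooth (partial_derivative b f)"
  unfolding smooth_def
proof (intro ballI)
  fix bs :: "'a list" assume bs: "bs \<in> lists Basis"
  \<comment> \<open>The new direction goes to the end of the list, since the last entry is
    differentiated first.\<close>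
  have "bs @ [b] \<in> lists Basis"
    using bs assms(2) by auto
  moreover have "iterated_partial (bs @ [b]) f = iterated_partial bs (partial_derivative b f)"
    by (simp add: iterated_partial_append)
  ultimately show "continuous_on UNIV (iterated_partial bs (partial_derivative b f)) \<and>
    (\<forall>c\<in>Basis. \<forall>z. (\<lambda>h::real. iterated_partial bs (partial_derivative b f) (z + h *\<^sub>R c)) differentiable (at 0))"
    using assms(1) unfolding smooth_def by metis
qed

lemma schwartz_partial_derivative:
  assumes "schwartz f" "b \<in> Basis"
  shows "schwartz (partial_derivative b f)"
  unfolding schwartz_def
proof (intro conjI allI ballI)
  show "smooth (partial_derivative b f)"
    using assms smooth_partial_derivative unfolding schwartz_def by blast
  fix k :: nat and bs :: "'a list" assume bs: "bs \<in> lists Basis"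
  have "bs @ [b] \<in> lists Basis"
    using bs assms(2) by auto
  moreover have "iterated_partial (bs @ [b]) f = iterated_partial bs (partial_derivative b f)"
    by (simp add: iterated_partial_append)
  ultimately show "\<exists>C. \<forall>z. (1 + norm z) ^ k * norm (iterated_partial bs (partial_derivative b f) z) \<le> C"
    using assms(1) unfolding schwartz_def by metis
qed

lemma smooth_continuous: "smooth f \<Longrightarrow> continuous_on UNIV f"
  unfolding smooth_def by (metis iterated_partial.simps(1) lists.Nil)

lemma smooth_has_vector_derivative:
  assumes "smooth f" "b \<in> Basis"
  shows "((\<lambda>h. f (z + h *\<^sub>R b)) has_vector_derivative partial_derivative b f z) (at 0)"
proof -
  have "(\<lambda>h::real. f (z + h *\<^sub>R b)) differentiable (at 0)"
    using assms unfolding smooth_def by (metis iterated_partial.simps(1) lists.Nil)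
  then show ?thesis
    unfolding partial_derivative_def by (simp add: vector_derivative_works)
qed

text \<open>Partial derivatives are given at parameter 0 only; moving the base point along the line
  reaches every other parameter, as the mean value theorem requires.\<close>

lemma has_vector_derivative_along_line:
  fixes f :: "'a::real_vector \<Rightarrow> 'b::real_normed_vector"
  assumes "\<And>u. ((\<lambda>h. f (u + h *\<^sub>R b)) has_vector_derivative D u) (at 0)"
  shows "((\<lambda>h. f (z + h *\<^sub>R b)) has_vector_derivative D (z + h *\<^sub>R b)) (at h)"
proof -
  have 1: "((\<lambda>k. k - h) has_vector_derivative 1) (at h)"
    by (auto intro!: derivative_eq_intros)
  have 2: "((\<lambda>k. f ((z + h *\<^sub>R b) + k *\<^sub>R b)) has_vector_derivative D (z + h *\<^sub>R b)) (at (h - h))"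
    using assms[of "z + h *\<^sub>R b"] by simp
  have 3: "(\<lambda>k. f ((z + h *\<^sub>R b) + k *\<^sub>R b)) \<circ> (\<lambda>k. k - h) = (\<lambda>k. f (z + k *\<^sub>R b))"
    by (auto simp: fun_eq_iff algebra_simps)
  show ?thesis
    using vector_diff_chain_at[OF 1 2] 3 by simp
qed

text \<open>Mean value inequality; \<open>closed_segment\<close> spares an ordering of the two
  endpoints, which matters because coordinate increments may be negative.\<close>

lemma norm_diff_le_vector_derivative:
  fixes f :: "real \<Rightarrow> 'b::real_normed_vector"
  assumes f: "\<And>x. (f has_vector_derivative f' x) (at x)"
    and B: "\<And>x. x \<in> closed_segment a b \<Longrightarrow> norm (f' x) \<le> B"
  shows "norm (f b - f a) \<le> B * \<bar>b - a\<bar>"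
proof -
  have "norm (f b - f a) \<le> B * norm (b - a)"
  proof (rule differentiable_bound[where S = "closed_segment a b" and f' = "\<lambda>x h. h *\<^sub>R f' x"])
    show "(f has_derivative (\<lambda>h. h *\<^sub>R f' x)) (at x within closed_segment a b)" for x
      using f[of x] unfolding has_vector_derivative_def by (rule has_derivative_at_withinI)
    show "onorm (\<lambda>h. h *\<^sub>R f' x) \<le> B" if "x \<in> closed_segment a b" for x
      by (rule onorm_le) (use B[OF that] in \<open>simp add: mult.commute[of B] mult_left_mono\<close>)
  qed auto
  then show ?thesis by simp
qed

text \<open>\<open>smooth\<close> supplies derivatives along the axes and no total derivative, so
  the path from \<open>p\<close> to \<open>q\<close> changes one coordinate at a time. It never
  leaves the coordinate box spanned by \<open>p\<close> and \<open>q\<close>, the only place where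
  \<open>M\<close> has to bound the derivatives.\<close>

lemma norm_diff_le_partial_derivatives:
  fixes f :: "'a::euclidean_space \<Rightarrow> 'b::real_normed_vector"
  assumes f: "\<And>b u. b \<in> Basis \<Longrightarrow> ((\<lambda>h. f (u + h *\<^sub>R b)) has_vector_derivative D b u) (at 0)"
    and M: "\<And>b u. b \<in> Basis \<Longrightarrow> (\<forall>c\<in>Basis. u \<bullet> c \<in> closed_segment (p \<bullet> c) (q \<bullet> c)) \<Longrightarrow> norm (D b u) \<le> M"
  shows "norm (f q - f p) \<le> M * (\<Sum>b\<in>Basis. \<bar>(q - p) \<bullet> b\<bar>)"
proof -
  let ?P = "\<lambda>S. p + (\<Sum>b\<in>S. ((q - p) \<bullet> b) *\<^sub>R b)"
  \<comment> \<open>\<open>S\<close> is the set of coordinates already moved from \<open>p\<close>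
    to \<open>q\<close>.\<close>
  have "norm (f (?P S) - f p) \<le> M * (\<Sum>b\<in>S. \<bar>(q - p) \<bullet> b\<bar>)" if "S \<subseteq> Basis" for S
    using finite_subset[OF that finite_Basis] that
  proof (induction S rule: finite_induct)
    case empty
    then show ?case by simp
  next
    case (insert b S)
    have b: "b \<in> Basis" and S: "S \<subseteq> Basis"
      using insert by auto
    have coord: "?P S \<bullet> c = (if c \<in> S then q \<bullet> c else p \<bullet> c)" if "c \<in> Basis" for c
    proof -
      have "(\<Sum>b\<in>S. ((q - p) \<bullet> b) *\<^sub>R b) \<bullet> c = (\<Sum>b\<in>S. if b = c then (q - p) \<bullet> c else 0)"
        unfolding inner_sum_left using S that
        by (intro sum.cong) (auto simp: inner_Basis)
      then show ?thesis
        using insert(1) by (simp add: inner_simps)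
    qed
    let ?d = "(q - p) \<bullet> b"
    have "norm (f (?P S + ?d *\<^sub>R b) - f (?P S + 0 *\<^sub>R b)) \<le> M * \<bar>?d - 0\<bar>"
    proof (rule norm_diff_le_vector_derivative)
      show "((\<lambda>h. f (?P S + h *\<^sub>R b)) has_vector_derivative D b (?P S + x *\<^sub>R b)) (at x)" for x
        using f[OF b] by (rule has_vector_derivative_along_line)
      fix x assume x: "x \<in> closed_segment 0 ?d"
      show "norm (D b (?P S + x *\<^sub>R b)) \<le> M"
      proof (rule M[OF b], intro ballI)
        fix c :: 'a assume c: "c \<in> Basis"
        have "(?P S + x *\<^sub>R b) \<bullet> c = (if c \<in> S then q \<bullet> c else if c = b then p \<bullet> c + x else p \<bullet> c)"
          using coord[OF c] b c insert(2) by (auto simp: inner_add_left inner_Basis)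
        then show "(?P S + x *\<^sub>R b) \<bullet> c \<in> closed_segment (p \<bullet> c) (q \<bullet> c)"
          using x by (auto simp: closed_segment_eq_real_ivl inner_diff_left split: if_splits)
      qed
    qed
    moreover have "?P (insert b S) = ?P S + ?d *\<^sub>R b"
      using insert by (simp add: algebra_simps)
    ultimately have "norm (f (?P (insert b S)) - f (?P S)) \<le> M * \<bar>?d\<bar>"
      by (simp add: add.assoc)
    moreover have "norm (f (?P S) - f p) \<le> M * (\<Sum>b\<in>S. \<bar>(q - p) \<bullet> b\<bar>)"
      using insert.IH S by simp
    ultimately show ?case
      using norm_diff_triangle_le[of "f (?P (insert b S))" "f (?P S)" _ "f p"] insert(1,2)
      by (simp add: distrib_left)
  qed
  from this[of Basis] show ?thesis
    by (simp add: euclidean_representation)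
qed

text \<open>Only space is reflected: the operator looks forward in time, so both shifted points have
  the same time. Cancellation is of second order in space but of first order in time, in accordance
  with parabolic scaling.\<close>

definition second_difference ::
    "('a::real_vector \<times> real \<Rightarrow> 'b::real_vector) \<Rightarrow> 'a \<times> real \<Rightarrow> 'a \<times> real \<Rightarrow> 'b"
  where "second_difference f X Z = 2 *\<^sub>R f X - f (X + Z) - f (X + (- fst Z, snd Z))"

text \<open>The point \<open>T\<close>, which is \<open>X\<close> moved in time only, splits the
  expression into a time increment of order r and a symmetric second difference in space around
  \<open>T\<close>, of order |y|^2. The bound \<open>M\<close> is required only near
  \<open>X\<close>, so that the decay of \<open>f\<close> at \<open>X\<close> can be fed in
  later.\<close>

lemma norm_second_difference_le:
  fixes f :: "'a::euclidean_space \<times> real \<Rightarrow> 'b::real_normed_vector"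
  assumes f: "smooth f" and r: "0 \<le> r"
    and M: "\<And>U. norm (fst U - fst X) \<le> norm y \<Longrightarrow> \<bar>snd U - snd X\<bar> \<le> r \<Longrightarrow>
       norm (f U) \<le> M \<and> (\<forall>b\<in>Basis. norm (partial_derivative b f U) \<le> M \<and>
         (\<forall>c\<in>Basis. norm (partial_derivative c (partial_derivative b f) U) \<le> M))"
  shows "norm (second_difference f X (y, r)) \<le> 4 * M * (real DIM('a) + 1)\<^sup>2 * min 1 ((norm y)\<^sup>2 + r)"
proof -
  define N where "N = real DIM('a \<times> real)"
  define T where "T = X + (0, r)"
  define z where "z = (y, 0::real)"
  have N: "1 \<le> N" "N = real DIM('a) + 1"
    by (auto simp: N_def)
  have "norm (f X) \<le> M"
    using M[of X] r by auto
  then have M_nonneg: "0 \<le> M"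
    using norm_ge_zero order_trans by blast
  have sum_le: "(\<Sum>b\<in>Basis. \<bar>w \<bullet> b\<bar>) \<le> N * norm w" for w :: "'a \<times> real"
    unfolding N_def by (rule sum_bounded_above) (simp add: Basis_le_norm)
  \<comment> \<open>Every axis-parallel path below stays in the coordinate box around
    \<open>X\<close> described here, which lies where \<open>M\<close> is assumed to be a
    bound.\<close>
  have near: "norm (fst U - fst X) \<le> norm y \<and> \<bar>snd U - snd X\<bar> \<le> r"
    if U: "\<forall>b\<in>Basis. \<bar>(U - X) \<bullet> b\<bar> \<le> \<bar>(y, r) \<bullet> b\<bar>" for U
  proof
    show "norm (fst U - fst X) \<le> norm y"
    proof (rule norm_le_componentwise)
      fix i :: 'a assume "i \<in> Basis"
      then have "(i, 0::real) \<in> Basis" by (simp add: Basis_prod_def)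
      then show "\<bar>(fst U - fst X) \<bullet> i\<bar> \<le> \<bar>y \<bullet> i\<bar>"
        using U by (fastforce simp: inner_prod_def)
    qed
    have "(0::'a, 1::real) \<in> Basis" by (simp add: Basis_prod_def)
    then show "\<bar>snd U - snd X\<bar> \<le> r"
      using U r by (fastforce simp: inner_prod_def)
  qed
  have time: "norm (f T - f X) \<le> M * (N * r)"
  proof -
    have "norm (f T - f X) \<le> M * (\<Sum>b\<in>Basis. \<bar>(T - X) \<bullet> b\<bar>)"
    proof (rule norm_diff_le_partial_derivatives)
      show "((\<lambda>h. f (u + h *\<^sub>R b)) has_vector_derivative partial_derivative b f u) (at 0)"
        if "b \<in> Basis" for b u
        using f that by (rule smooth_has_vector_derivative)
      fix b u :: "'a \<times> real"
      assume b: "b \<in> Basis" and u: "\<forall>c\<in>Basis. u \<bullet> c \<in> closed_segment (X \<bullet> c) (T \<bullet> c)"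
      have "\<forall>c\<in>Basis. \<bar>(u - X) \<bullet> c\<bar> \<le> \<bar>(y, r) \<bullet> c\<bar>"
      proof
        fix c :: "'a \<times> real" assume c: "c \<in> Basis"
        have "\<bar>(u - X) \<bullet> c\<bar> \<le> \<bar>(0, r) \<bullet> c\<bar>"
          using u[rule_format, OF c]
          by (auto simp: T_def inner_add_left inner_diff_left closed_segment_eq_real_ivl split: if_splits)
        also have "\<dots> \<le> \<bar>(y, r) \<bullet> c\<bar>"
          using c by (auto simp: Basis_prod_def)
        finally show "\<bar>(u - X) \<bullet> c\<bar> \<le> \<bar>(y, r) \<bullet> c\<bar>" .
      qed
      with near M b show "norm (partial_derivative b f u) \<le> M" by blast
    qed
    also have "\<dots> \<le> M * (N * norm (T - X))"
      using sum_le M_nonneg by (intro mult_left_mono)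
    finally show ?thesis
      using r by (simp add: T_def norm_Pair)
  qed
  have deriv_diff: "norm (partial_derivative b f (T + u) - partial_derivative b f (T - u)) \<le> 2 * M * N * norm y"
    if b: "b \<in> Basis" and u: "\<forall>c\<in>Basis. \<bar>u \<bullet> c\<bar> \<le> \<bar>z \<bullet> c\<bar>" for b u
  proof -
    have "norm (partial_derivative b f (T + u) - partial_derivative b f (T - u))
      \<le> M * (\<Sum>c\<in>Basis. \<bar>((T + u) - (T - u)) \<bullet> c\<bar>)"
    proof (rule norm_diff_le_partial_derivatives)
      show "((\<lambda>h. partial_derivative b f (v + h *\<^sub>R c)) has_vector_derivative
          partial_derivative c (partial_derivative b f) v) (at 0)" if "c \<in> Basis" for c v
        using smooth_partial_derivative[OF f b] that by (rule smooth_has_vector_derivative)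
      fix c v :: "'a \<times> real"
      assume c: "c \<in> Basis"
        and v: "\<forall>d\<in>Basis. v \<bullet> d \<in> closed_segment ((T - u) \<bullet> d) ((T + u) \<bullet> d)"
      have "\<forall>d\<in>Basis. \<bar>(v - X) \<bullet> d\<bar> \<le> \<bar>(y, r) \<bullet> d\<bar>"
      proof
        fix d :: "'a \<times> real" assume d: "d \<in> Basis"
        have "\<bar>(v - X) \<bullet> d - (0, r) \<bullet> d\<bar> \<le> \<bar>u \<bullet> d\<bar>"
          using v[rule_format, OF d]
          by (auto simp: T_def inner_add_left inner_diff_left closed_segment_eq_real_ivl split: if_splits)
        also have "\<dots> \<le> \<bar>z \<bullet> d\<bar>"
          using u d by blast
        finally show "\<bar>(v - X) \<bullet> d\<bar> \<le> \<bar>(y, r) \<bullet> d\<bar>"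
          using d r by (auto simp: Basis_prod_def z_def)
      qed
      with near M b c show "norm (partial_derivative c (partial_derivative b f) v) \<le> M" by blast
    qed
    also have "\<dots> \<le> M * (N * norm ((T + u) - (T - u)))"
      using sum_le M_nonneg by (intro mult_left_mono)
    also have "norm ((T + u) - (T - u)) \<le> 2 * norm y"
    proof -
      have "norm u \<le> norm z"
        using u by (intro norm_le_componentwise) blast
      moreover have "(T + u) - (T - u) = 2 *\<^sub>R u"
        by (simp add: scaleR_2)
      ultimately show ?thesis
        by (simp add: z_def norm_Pair)
    qed
    finally show ?thesis
      using M_nonneg N(1) by (simp add: mult_left_mono mult.assoc mult.left_commute)
  qed
  \<comment> \<open>An even function of \<open>u\<close>: its partial derivatives are differences of
    those of \<open>f\<close> at \<open>T + u\<close> and \<open>T - u\<close>, which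
    \<open>deriv_diff\<close> bounds by a multiple of |y|. A second mean value step then yields
    |y|^2.\<close>
  define g where "g u = f (T + u) + f (T - u)" for u
  have space: "norm (g z - g 0) \<le> (2 * M * N * norm y) * (N * norm y)"
  proof -
    have "norm (g z - g 0) \<le> (2 * M * N * norm y) * (\<Sum>b\<in>Basis. \<bar>(z - 0) \<bullet> b\<bar>)"
    proof (rule norm_diff_le_partial_derivatives)
      fix b u :: "'a \<times> real" assume b: "b \<in> Basis"
      \<comment> \<open>The point \<open>- 0\<close> is the image of 0 under \<open>uminus\<close>,
        the form that the chain rule expects.\<close>
      have *: "((\<lambda>h. f (T - u + h *\<^sub>R b)) has_vector_derivative partial_derivative b f (T - u)) (at (- 0))"
        using smooth_has_vector_derivative[OF f b] by simp
      have "((\<lambda>h. f (T - u + h *\<^sub>R b)) \<circ> uminus has_vector_derivative (- 1) *\<^sub>R partial_derivative b f (T - u)) (at 0)"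
        by (rule vector_diff_chain_at[where f = uminus]) (use * in \<open>auto intro!: derivative_eq_intros\<close>)
      moreover have "((\<lambda>h. f (T + u + h *\<^sub>R b)) has_vector_derivative partial_derivative b f (T + u)) (at 0)"
        using smooth_has_vector_derivative[OF f b] by simp
      ultimately have "((\<lambda>h. f (T + u + h *\<^sub>R b) + ((\<lambda>h. f (T - u + h *\<^sub>R b)) \<circ> uminus) h) has_vector_derivative
         partial_derivative b f (T + u) + (- 1) *\<^sub>R partial_derivative b f (T - u)) (at 0)"
        by (intro has_vector_derivative_add)
      moreover have "(\<lambda>h. f (T + u + h *\<^sub>R b) + ((\<lambda>h. f (T - u + h *\<^sub>R b)) \<circ> uminus) h) = (\<lambda>h. g (u + h *\<^sub>R b))"
        by (simp add: g_def fun_eq_iff algebra_simps)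
      ultimately show "((\<lambda>h. g (u + h *\<^sub>R b)) has_vector_derivative
          partial_derivative b f (T + u) - partial_derivative b f (T - u)) (at 0)"
        by simp
      assume "\<forall>c\<in>Basis. u \<bullet> c \<in> closed_segment (0 \<bullet> c) (z \<bullet> c)"
      then have "\<forall>c\<in>Basis. \<bar>u \<bullet> c\<bar> \<le> \<bar>z \<bullet> c\<bar>"
        by (fastforce simp: closed_segment_eq_real_ivl split: if_splits)
      then show "norm (partial_derivative b f (T + u) - partial_derivative b f (T - u)) \<le> 2 * M * N * norm y"
        using deriv_diff b by blast
    qed
    also have "\<dots> \<le> (2 * M * N * norm y) * (N * norm z)"
      using sum_le[of z] M_nonneg N by (intro mult_left_mono) auto
    finally show ?thesis
      by (simp add: z_def norm_Pair)
  qed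
  have eq: "second_difference f X (y, r) = - (2 *\<^sub>R (f T - f X)) - (g z - g 0)"
  proof -
    have "T + z = X + (y, r)" "T - z = X + (- y, r)"
      by (simp_all add: T_def z_def prod_eq_iff)
    then show ?thesis
      by (simp add: second_difference_def g_def algebra_simps scaleR_2)
  qed
  have "norm (second_difference f X (y, r)) \<le> 2 * (M * (N * r)) + (2 * M * N * norm y) * (N * norm y)"
    unfolding eq using time space norm_triangle_ineq4[of "- (2 *\<^sub>R (f T - f X))" "g z - g 0"] by simp
  \<comment> \<open>A factor \<open>N\<close> is wasted on the time term so that both terms share
    \<open>N\<close> squared.\<close>
  also have "M * (N * r) \<le> M * (N * (N * r))"
    using N r M_nonneg by (intro mult_left_mono) (auto simp: mult_le_cancel_right1)
  finally have 1: "norm (second_difference f X (y, r)) \<le> 2 * M * N\<^sup>2 * ((norm y)\<^sup>2 + r)"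
    by (simp add: power2_eq_square algebra_simps)
  \<comment> \<open>The trivial bound by four values of \<open>f\<close> accounts for the 1 in the
    minimum.\<close>
  have "norm (f (X + (y, r))) \<le> M" "norm (f (X + (- y, r))) \<le> M"
    using M r by simp_all
  then have "norm (second_difference f X (y, r)) \<le> 2 * M + M + M"
    unfolding second_difference_def fst_conv snd_conv using \<open>norm (f X) \<le> M\<close>
    by (intro norm_diff_triangle_le norm_triangle_le_diff add_mono) auto
  also have "2 * M + M + M = 4 * M * 1"
    by simp
  also have "\<dots> \<le> 4 * M * N\<^sup>2"
    using N(1) M_nonneg by (intro mult_left_mono one_le_power) auto
  finally have 2: "norm (second_difference f X (y, r)) \<le> 4 * M * N\<^sup>2" .
  have "2 * M * N\<^sup>2 * ((norm y)\<^sup>2 + r) \<le> 4 * M * N\<^sup>2 * ((norm y)\<^sup>2 + r)"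
    using M_nonneg r by (intro mult_right_mono) auto
  with 1 2 show ?thesis
    unfolding N(2)[symmetric] by (simp add: min_def)
qed

section \<open>The parabolic heat kernel\<close>

text \<open>Covers translations (\<open>c = 1\<close>) and point reflections
  (\<open>c = - 1\<close>) at once; the Jacobian factor is 1 in both cases.\<close>

lemma lborel_distr_sign_affine:
  fixes t :: "'a::euclidean_space"
  assumes "\<bar>c\<bar> = 1"
  shows "distr lborel borel (\<lambda>x. t + c *\<^sub>R x) = lborel"
proof -
  have "lborel = density (distr lborel borel (\<lambda>x. t + c *\<^sub>R x)) (\<lambda>_. \<bar>c\<bar> ^ DIM('a))"
    using assms by (intro lborel_affine) auto
  then show ?thesis
    using assms by (simp add: density_1)
qed

lemma lborel_distr_reflect_fst:
  fixes X :: "'a::euclidean_space \<times> real"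
  shows "distr lborel borel (\<lambda>Z. X + (- fst Z, snd Z)) = lborel"
proof -
  \<comment> \<open>A basis vector of the product is (i, 0) or (0, 1), so \<open>snd j = 0\<close>
    singles out the spatial directions; the map is diagonal with entries 1 and -1.\<close>
  define c where "c j = (if snd j = 0 then - 1 else 1 :: real)" for j :: "'a \<times> real"
  have "(\<Sum>j\<in>Basis. (c j * (Z \<bullet> j)) *\<^sub>R j) = (- fst Z, snd Z)" for Z :: "'a \<times> real"
  proof (rule euclidean_eqI)
    fix b :: "'a \<times> real" assume b: "b \<in> Basis"
    have "(\<Sum>j\<in>Basis. (c j * (Z \<bullet> j)) *\<^sub>R j) \<bullet> b = c b * (Z \<bullet> b)"
      using b by simp
    also have "\<dots> = (- fst Z, snd Z) \<bullet> b"
      using b by (auto simp: c_def Basis_prod_def inner_prod_def)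
    finally show "(\<Sum>j\<in>Basis. (c j * (Z \<bullet> j)) *\<^sub>R j) \<bullet> b = (- fst Z, snd Z) \<bullet> b" .
  qed
  moreover have "lborel = density (distr lborel borel (\<lambda>Z. X + (\<Sum>j\<in>Basis. (c j * (Z \<bullet> j)) *\<^sub>R j)))
     (\<lambda>_. (\<Prod>j\<in>Basis. \<bar>c j\<bar>))"
    by (rule lborel_affine_euclidean) (auto simp: c_def)
  moreover have "(\<Prod>j\<in>Basis. \<bar>c j\<bar>) = 1"
    by (rule prod.neutral) (auto simp: c_def)
  ultimately show ?thesis
    by (simp add: density_1)
qed

section \<open>Product Cauchy weights and elementary Gaussian bounds\<close>

lemma integrable_inverse_one_plus_square: "integrable lborel (\<lambda>v::real. 1 / (1 + v\<^sup>2))"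
  using integrable_inverse_1_plus_square
  by (simp add: set_integrable_def einterval_def inverse_eq_divide)

text \<open>Tonelli separates the coordinates, and v = sqrt r * v' in each of them produces the
  factor r^(n/2) that balances the n/2 in the kernel exponent.\<close>

lemma nn_integral_scaled_Cauchy_weight:
  assumes r: "0 < r"
  shows "(\<integral>\<^sup>+y. ennreal (\<Prod>b\<in>Basis. 1 / (1 + (y \<bullet> b)\<^sup>2 / r)) \<partial>(lborel :: 'a::euclidean_space measure))
    = ennreal ((sqrt r * (LINT v|lborel. 1 / (1 + v\<^sup>2))) ^ DIM('a))"
proof -
  let ?I = "LINT v|lborel. 1 / (1 + v\<^sup>2)"
  have I: "(\<integral>\<^sup>+v. ennreal (1 / (1 + v\<^sup>2)) \<partial>lborel) = ennreal ?I"
    using integrable_inverse_one_plus_square by (intro nn_integral_eq_integral) auto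
  have "(\<integral>\<^sup>+v. ennreal (1 / (1 + v\<^sup>2 / r)) \<partial>lborel)
      = ennreal \<bar>sqrt r\<bar> * (\<integral>\<^sup>+v. ennreal (1 / (1 + (0 + sqrt r * v)\<^sup>2 / r)) \<partial>lborel)"
    using r by (intro nn_integral_real_affine) auto
  also have "\<dots> = ennreal (sqrt r * ?I)"
    using r I by (simp add: power_mult_distrib ennreal_mult)
  finally have one_dim: "(\<integral>\<^sup>+v. ennreal (1 / (1 + v\<^sup>2 / r)) \<partial>lborel) = ennreal (sqrt r * ?I)" .
  have "(\<integral>\<^sup>+y. ennreal (\<Prod>b\<in>Basis. 1 / (1 + (y \<bullet> b)\<^sup>2 / r)) \<partial>(lborel :: 'a measure))
    = (\<integral>\<^sup>+y. (\<Prod>b\<in>Basis. ennreal (1 / (1 + (y \<bullet> b)\<^sup>2 / r))) \<partial>(lborel :: 'a measure))"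
    using r by (subst prod_ennreal) auto
  also have "\<dots> = (\<Prod>b\<in>(Basis :: 'a set). (\<integral>\<^sup>+v. ennreal (1 / (1 + v\<^sup>2 / r)) \<partial>lborel))"
    by (rule nn_integral_lborel_prod) auto
  finally show ?thesis
    using r by (simp add: one_dim ennreal_power)
qed

lemma integrable_Cauchy_weight:
  "integrable lborel (\<lambda>z::'a::euclidean_space. \<Prod>b\<in>Basis. 1 / (1 + (z \<bullet> b)\<^sup>2))"
proof (rule integrableI_nonneg)
  show "(\<integral>\<^sup>+(z::'a). ennreal (\<Prod>b\<in>Basis. 1 / (1 + (z \<bullet> b)\<^sup>2)) \<partial>lborel) < \<infinity>"
    using nn_integral_scaled_Cauchy_weight[of 1, where 'a = 'a] by simp
qed (auto intro!: prod_nonneg)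

text \<open>Raising 1 + x <= e^x at x = u / (4p) to the power p yields exactly e^(u/4); the
  condition 4p >= 1 gives 1 + u <= 4p + u.\<close>

lemma one_plus_powr_mult_exp_le:
  fixes u p :: real
  assumes u: "0 \<le> u" and p: "1 \<le> 4 * p"
  shows "(1 + u) powr p * exp (- (u / 4)) \<le> (4 * p) powr p"
proof -
  have "1 + u \<le> 4 * p * (1 + u / (4 * p))"
    using p by (simp add: field_simps)
  also have "\<dots> \<le> 4 * p * exp (u / (4 * p))"
    using p exp_ge_add_one_self by (intro mult_left_mono) auto
  finally have "(1 + u) powr p \<le> (4 * p * exp (u / (4 * p))) powr p"
    using u p by (intro powr_mono2) auto
  also have "\<dots> = (4 * p) powr p * exp (u / 4)"
    using p by (simp add: powr_mult exp_powr_real)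
  finally show ?thesis
    by (simp add: exp_minus field_simps)
qed

lemma prod_one_plus_le_power:
  fixes y :: "'a::euclidean_space"
  assumes "0 < r"
  shows "(\<Prod>b\<in>Basis. 1 + (y \<bullet> b)\<^sup>2 / r) \<le> (1 + (norm y)\<^sup>2 / r) ^ DIM('a)"
proof -
  have "(\<Prod>b\<in>Basis. 1 + (y \<bullet> b)\<^sup>2 / r) \<le> (\<Prod>b\<in>(Basis::'a set). 1 + (norm y)\<^sup>2 / r)"
  proof (rule prod_mono, intro conjI)
    fix b :: 'a assume "b \<in> Basis"
    then have "(y \<bullet> b)\<^sup>2 \<le> (norm y)\<^sup>2"
      using Basis_le_norm[of b y] by (simp add: abs_le_square_iff[symmetric])
    then show "1 + (y \<bullet> b)\<^sup>2 / r \<le> 1 + (norm y)\<^sup>2 / r"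
      using assms by (simp add: divide_right_mono)
  qed (use assms in auto)
  then show ?thesis by simp
qed

text \<open>For a = n/2 + 1 + s this is, up to a constant, the Gauss-Weierstrass kernel times
  \<open>r powr (- 1 - s)\<close>. The extension by 0 to r <= 0 turns all integrals into integrals
  over the whole space, where translations and reflections act freely.\<close>

definition heat_kernel :: "real \<Rightarrow> 'a::real_normed_vector \<times> real \<Rightarrow> real"
  where "heat_kernel a Z = (if 0 < snd Z then exp (- ((norm (fst Z))\<^sup>2 / (4 * snd Z))) / snd Z powr a else 0)"

lemma heat_kernel_nonneg: "0 \<le> heat_kernel a Z"
  by (simp add: heat_kernel_def)

lemma borel_measurable_heat_kernel [measurable]:
  "heat_kernel a \<in> borel_measurable (borel :: ('a::euclidean_space \<times> real) measure)"
  unfolding heat_kernel_def[abs_def] borel_prod[symmetric] by measurable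

lemma heat_kernel_eq:
  assumes "0 < r"
  shows "heat_kernel a (y, r) = exp (- ((norm y)\<^sup>2 / r / 4)) * r powr (- a)"
proof -
  have "(norm y)\<^sup>2 / (4 * r) = (norm y)\<^sup>2 / r / 4"
    by simp
  then show ?thesis
    using assms unfolding heat_kernel_def by (simp only: fst_conv snd_conv if_True powr_minus_divide times_divide_eq_right mult_1_right)
qed

text \<open>With u = |y|^2 / r one has |y|^2 + r = r (1 + u), so trading the Gaussian for
  \<open>(1 + u) powr (- a)\<close> gives the parabolically homogeneous bound. It controls the
  kernel far from its singularity.\<close>

lemma heat_kernel_le:
  assumes r: "0 < r" and a: "1 \<le> 4 * a"
  shows "heat_kernel a (y, r) \<le> (4 * a) powr a * ((norm y)\<^sup>2 + r) powr (- a)"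
proof -
  define u where "u = (norm y)\<^sup>2 / r"
  have u: "0 \<le> u" using r by (simp add: u_def)
  have eq: "(norm y)\<^sup>2 + r = r * (1 + u)"
    using r by (simp add: u_def field_simps)
  have "(1 + u) powr a * exp (- (u / 4)) \<le> (4 * a) powr a"
    using one_plus_powr_mult_exp_le[OF u a] .
  then have "exp (- (u / 4)) \<le> (4 * a) powr a * (1 + u) powr (- a)"
    using u by (simp add: powr_minus field_simps)
  then have "exp (- (u / 4)) * r powr (- a) \<le> (4 * a) powr a * (1 + u) powr (- a) * r powr (- a)"
    by (rule mult_right_mono) simp
  also have "\<dots> = (4 * a) powr a * ((norm y)\<^sup>2 + r) powr (- a)"
    unfolding eq using r u by (simp add: powr_mult)
  finally show ?thesis
    using r by (simp add: heat_kernel_eq u_def)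
qed

text \<open>The integrand is \<open>r powr (- s)\<close> near 0, integrable because s < 1, and
  \<open>r powr (- 1 - s)\<close> at infinity, integrable because s > 0.\<close>

lemma integrable_min_powr:
  assumes s: "0 < s" "s < (1::real)"
  shows "integrable lborel (\<lambda>r. indicator {0<..} r * (min 1 r * r powr (- 1 - s)))"
proof (rule integrableI_nonneg)
  have A: "(\<integral>\<^sup>+r. ennreal (r powr (- s)) * indicator {0..1} r \<partial>lborel) < \<infinity>"
    using nn_integral_has_integral_lebesgue'[OF _ has_integral_powr_from_0[of "- s" 1]] s by simp
  have B: "(\<integral>\<^sup>+r. ennreal (r powr (- 1 - s)) * indicator {1..} r \<partial>lborel) < \<infinity>"
    using nn_integral_has_integral_lebesgue'[OF _ has_integral_powr_to_inf[of "- 1 - s" 1]] s by simp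
  have "(\<integral>\<^sup>+r. ennreal (indicator {0<..} r * (min 1 r * r powr (- 1 - s))) \<partial>lborel)
    \<le> (\<integral>\<^sup>+r. ennreal (r powr (- s)) * indicator {0..1} r + ennreal (r powr (- 1 - s)) * indicator {1..} r \<partial>lborel)"
  proof (rule nn_integral_mono)
    fix r :: real
    consider "r \<le> 0" | "0 < r" "r < 1" | "1 \<le> r" by linarith
    then show "ennreal (indicator {0<..} r * (min 1 r * r powr (- 1 - s)))
      \<le> ennreal (r powr (- s)) * indicator {0..1} r + ennreal (r powr (- 1 - s)) * indicator {1..} r"
    proof cases
      case 2
      then have "r * r powr (- 1 - s) = r powr (- s)"
        using powr_mult_base[of r "- 1 - s"] by simp
      then show ?thesis using 2 by (simp add: min_def)
    qed (auto simp: min_def indicator_def)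
  qed
  also have "\<dots> < \<infinity>"
    using A B by (subst nn_integral_add) auto
  finally show "(\<integral>\<^sup>+r. ennreal (indicator {0<..} r * (min 1 r * r powr (- 1 - s))) \<partial>lborel) < \<infinity>" .
qed (auto simp: indicator_def)

lemma heat_kernel_mult_min_le:
  fixes y :: "'a::euclidean_space"
  assumes r: "0 < r"
  shows "heat_kernel a (y, r) * min 1 ((norm y)\<^sup>2 + r)
    \<le> (4 * (real DIM('a) + 1)) ^ (DIM('a) + 1) * (min 1 r * r powr (- a)) * (\<Prod>b\<in>Basis. 1 / (1 + (y \<bullet> b)\<^sup>2 / r))"
proof -
  define u where "u = (norm y)\<^sup>2 / r"
  \<comment> \<open>Of the n + 1 powers of 1 + u taken from the Gaussian, one reduces |y|^2 + r to r
    in the minimum and n pay for the product \<open>P\<close>.\<close>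
  define p where "p = real DIM('a) + 1"
  define P where "P = (\<Prod>b\<in>Basis. 1 + (y \<bullet> b)\<^sup>2 / r)"
  have u: "0 \<le> u" using r by (simp add: u_def)
  have eq: "(norm y)\<^sup>2 + r = r * (1 + u)"
    using r by (simp add: u_def field_simps)
  have P: "0 < P" "P \<le> (1 + u) ^ DIM('a)"
    using r prod_one_plus_le_power[OF r, of y] by (auto simp: P_def u_def intro!: prod_pos add_pos_nonneg)
  have "(1 + u) powr p * exp (- (u / 4)) \<le> (4 * p) powr p"
    using u by (rule one_plus_powr_mult_exp_le) (simp add: p_def)
  moreover have "(1 + u) powr p = (1 + u) ^ (DIM('a) + 1)" "(4 * p) powr p = (4 * p) ^ (DIM('a) + 1)"
    using u powr_realpow[of "1 + u" "DIM('a) + 1"] powr_realpow[of "4 * p" "DIM('a) + 1"] by (auto simp: p_def add.commute)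
  ultimately have "(1 + u) * exp (- (u / 4)) * (1 + u) ^ DIM('a) \<le> (4 * p) ^ (DIM('a) + 1)"
    by (simp add: mult_ac)
  moreover have "(1 + u) * exp (- (u / 4)) * P \<le> (1 + u) * exp (- (u / 4)) * (1 + u) ^ DIM('a)"
    using P u by (intro mult_left_mono) auto
  ultimately have "(1 + u) * exp (- (u / 4)) * P \<le> (4 * p) ^ (DIM('a) + 1)"
    by linarith
  then have e: "(1 + u) * exp (- (u / 4)) \<le> (4 * p) ^ (DIM('a) + 1) * (1 / P)"
    using P by (simp add: field_simps)
  have m: "min 1 ((norm y)\<^sup>2 + r) \<le> min 1 r * (1 + u)"
    unfolding eq using r u by (cases "r \<le> 1") auto
  have "heat_kernel a (y, r) * min 1 ((norm y)\<^sup>2 + r) \<le> heat_kernel a (y, r) * (min 1 r * (1 + u))"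
    using m heat_kernel_nonneg by (rule mult_left_mono)
  also have "\<dots> = ((1 + u) * exp (- (u / 4))) * (min 1 r * r powr (- a))"
    using r by (simp add: heat_kernel_eq u_def)
  also have "\<dots> \<le> ((4 * p) ^ (DIM('a) + 1) * (1 / P)) * (min 1 r * r powr (- a))"
    using e r by (intro mult_right_mono) auto
  also have "\<dots> = (4 * p) ^ (DIM('a) + 1) * (min 1 r * r powr (- a)) * (1 / P)"
    by (simp add: mult_ac)
  also have "1 / P = (\<Prod>b\<in>Basis. 1 / (1 + (y \<bullet> b)\<^sup>2 / r))"
    by (simp add: P_def prod_dividef)
  finally show ?thesis
    by (simp add: p_def)
qed

text \<open>Tonelli with y innermost reduces the claim to the one-dimensional integral of
  \<open>min 1 r * r powr (- 1 - s)\<close>. The function is the common majorant for integrability,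
  continuity and differentiation.\<close>

lemma integrable_heat_kernel_mult_min:
  fixes s :: real
  assumes s: "0 < s" "s < 1"
  shows "integrable lborel
    (\<lambda>Z::'a::euclidean_space \<times> real. heat_kernel (real DIM('a) / 2 + 1 + s) Z * min 1 ((norm (fst Z))\<^sup>2 + snd Z))"
    (is "integrable _ ?F")
proof (rule integrableI_nonneg)
  let ?a = "real DIM('a) / 2 + 1 + s"
  define J where "J = (LINT v|lborel. 1 / (1 + v\<^sup>2 :: real))"
  define C where "C = (4 * (real DIM('a) + 1)) ^ (DIM('a) + 1)"
  have C: "0 \<le> C" by (simp add: C_def)
  have J: "0 \<le> J" by (simp add: J_def)
  show meas: "?F \<in> borel_measurable lborel"
  proof -
    have "(\<lambda>Z :: 'a \<times> real. min 1 ((norm (fst Z))\<^sup>2 + snd Z)) \<in> borel_measurable borel"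
      by (intro borel_measurable_continuous_onI continuous_intros)
    then show ?thesis
      by simp
  qed
  show "AE Z in lborel. 0 \<le> ?F Z"
    by (rule AE_I2) (auto simp: heat_kernel_def)
  have inner: "(\<integral>\<^sup>+y. ennreal (?F (y, r)) \<partial>lborel)
    \<le> ennreal (C * J ^ DIM('a)) * ennreal (indicator {0<..} r * (min 1 r * r powr (- 1 - s)))" for r
  proof (cases "0 < r")
    case False
    then show ?thesis by (simp add: heat_kernel_def)
  next
    case True
    have "(\<integral>\<^sup>+y. ennreal (?F (y, r)) \<partial>lborel)
      \<le> (\<integral>\<^sup>+y. ennreal (C * (min 1 r * r powr (- ?a))) * ennreal (\<Prod>b\<in>Basis. 1 / (1 + (y \<bullet> b)\<^sup>2 / r)) \<partial>(lborel :: 'a measure))"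
    proof (rule nn_integral_mono)
      fix y :: 'a
      have "?F (y, r) \<le> C * (min 1 r * r powr (- ?a)) * (\<Prod>b\<in>Basis. 1 / (1 + (y \<bullet> b)\<^sup>2 / r))"
        using heat_kernel_mult_min_le[OF True, of ?a y] by (simp only: fst_conv snd_conv C_def)
      moreover have "0 \<le> C * (min 1 r * r powr (- ?a))"
        using C True by simp
      ultimately show "ennreal (?F (y, r)) \<le> ennreal (C * (min 1 r * r powr (- ?a))) * ennreal (\<Prod>b\<in>Basis. 1 / (1 + (y \<bullet> b)\<^sup>2 / r))"
        using True by (subst ennreal_mult[symmetric]) (auto intro!: prod_nonneg ennreal_leI)
    qed
    also have "\<dots> = ennreal (C * (min 1 r * r powr (- ?a))) * ennreal ((sqrt r * J) ^ DIM('a))"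
      using nn_integral_scaled_Cauchy_weight[OF True, where 'a = 'a]
      by (subst nn_integral_cmult) (auto simp: J_def)
    also have "\<dots> = ennreal (C * (min 1 r * r powr (- ?a)) * (sqrt r * J) ^ DIM('a))"
      using True C J by (intro ennreal_mult[symmetric]) auto
    also have "sqrt r ^ DIM('a) = r powr (real DIM('a) / 2)"
      using True by (simp add: powr_half_sqrt[symmetric] powr_power)
    then have "C * (min 1 r * r powr (- ?a)) * (sqrt r * J) ^ DIM('a)
      = C * J ^ DIM('a) * (min 1 r * (r powr (- ?a) * r powr (real DIM('a) / 2)))"
      by (simp add: power_mult_distrib mult_ac)
    \<comment> \<open>Here the n/2 from the spatial integral cancels the n/2 in the exponent of the
      kernel.\<close>
    also have "r powr (- ?a) * r powr (real DIM('a) / 2) = r powr (- 1 - s)"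
      by (simp add: powr_add[symmetric])
    finally show ?thesis
      using True C J by (simp add: ennreal_mult[symmetric])
  qed
  have "(\<integral>\<^sup>+Z. ennreal (?F Z) \<partial>lborel) = (\<integral>\<^sup>+Z. ennreal (?F Z) \<partial>((lborel :: 'a measure) \<Otimes>\<^sub>M (lborel :: real measure)))"
    by (simp add: lborel_prod)
  also have "\<dots> = (\<integral>\<^sup>+r. \<integral>\<^sup>+y. ennreal (?F (y, r)) \<partial>lborel \<partial>lborel)"
    using meas by (intro lborel_pair.nn_integral_snd[symmetric]) (simp add: lborel_prod)
  also have "\<dots> \<le> (\<integral>\<^sup>+r. ennreal (C * J ^ DIM('a)) * ennreal (indicator {0<..} r * (min 1 r * r powr (- 1 - s))) \<partial>lborel)"
    using inner by (rule nn_integral_mono)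
  also have "\<dots> = ennreal (C * J ^ DIM('a)) * (\<integral>\<^sup>+r. ennreal (indicator {0<..} r * (min 1 r * r powr (- 1 - s))) \<partial>lborel)"
    by (rule nn_integral_cmult) auto
  also have "\<dots> < \<infinity>"
  proof -
    have "(\<integral>\<^sup>+r. ennreal (indicator {0<..} r * (min 1 r * r powr (- 1 - s))) \<partial>lborel)
      = ennreal (LINT r|lborel. indicator {0<..} r * (min 1 r * r powr (- 1 - s)))"
      using integrable_min_powr[OF s] by (intro nn_integral_eq_integral) (auto simp: indicator_def)
    then show ?thesis
      by (simp add: ennreal_mult_less_top)
  qed
  finally show "(\<integral>\<^sup>+Z. ennreal (?F Z) \<partial>lborel) < \<infinity>" .
qed

section \<open>Smoothness\<close>

lemma continuous_on_lebesgue_integral: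
  fixes f :: "'a::metric_space \<Rightarrow> 'c \<Rightarrow> 'b::{banach, second_countable_topology}"
  assumes meas: "\<And>x. f x \<in> borel_measurable M"
    and cont: "\<And>z. continuous_on UNIV (\<lambda>x. f x z)"
    and w: "integrable M w" "\<And>x z. norm (f x z) \<le> w z"
  shows "continuous_on UNIV (\<lambda>x. integral\<^sup>L M (f x))"
proof -
  have "((\<lambda>x. integral\<^sup>L M (f x)) \<longlongrightarrow> integral\<^sup>L M (f x0)) (at x0)" for x0
    unfolding tendsto_at_iff_sequentially
  proof (intro allI impI)
    fix X assume "X \<longlonglongrightarrow> x0"
    then have lim: "(\<lambda>i. f (X i) z) \<longlonglongrightarrow> f x0 z" for z
      using cont[of z] by (auto simp: continuous_on_eq_continuous_at intro: isCont_tendsto_compose)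
    show "((\<lambda>x. integral\<^sup>L M (f x)) \<circ> X) \<longlonglongrightarrow> integral\<^sup>L M (f x0)"
      unfolding comp_def
      by (rule integral_dominated_convergence[where w = w]) (use meas w lim in auto)
  qed
  then show ?thesis
    by (simp add: continuous_on_def)
qed

text \<open>Dominated convergence for the remainder quotient \<open>q\<close>: by the mean value
  inequality the increment and the linear term are each at most
  \<open>w z * \<bar>h - h0\<bar>\<close>, so \<open>2 * w\<close> dominates
  \<open>q\<close>.\<close>

lemma has_vector_derivative_lebesgue_integral:
  fixes f :: "real \<Rightarrow> 'c \<Rightarrow> 'b::{banach, second_countable_topology}"
  assumes int: "\<And>h. integrable M (f h)"
    and meas: "f' h0 \<in> borel_measurable M"
    and deriv: "\<And>h z. ((\<lambda>h. f h z) has_vector_derivative f' h z) (at h)"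
    and w: "integrable M w" "\<And>h z. norm (f' h z) \<le> w z"
  shows "((\<lambda>h. integral\<^sup>L M (f h)) has_vector_derivative integral\<^sup>L M (f' h0)) (at h0)"
proof -
  have int': "integrable M (f' h0)"
    by (rule Bochner_Integration.integrable_bound[OF w(1) meas])
      (use w(2) in \<open>auto intro: order_trans[OF _ abs_ge_self]\<close>)
  define q where "q h z = (1 / norm (h - h0)) *\<^sub>R (f h z - (f h0 z + (h - h0) *\<^sub>R f' h0 z))" for h z
  have q_lim: "((\<lambda>h. q h z) \<longlongrightarrow> 0) (at h0)" for z
    using deriv[where h = h0 and z = z]
    unfolding has_vector_derivative_def has_derivative_within q_def by simp
  have q_int: "integrable M (q h)" for h
    unfolding q_def by (intro integrable_scaleR_right Bochner_Integration.integrable_diff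
        Bochner_Integration.integrable_add int int')
  have q_bound: "norm (q h z) \<le> 2 * w z" if "h \<noteq> h0" for h z
  proof -
    have "norm (f h z - f h0 z) \<le> w z * \<bar>h - h0\<bar>"
      using deriv w(2) by (rule norm_diff_le_vector_derivative)
    moreover have "norm ((h - h0) *\<^sub>R f' h0 z) \<le> w z * \<bar>h - h0\<bar>"
      using w(2)[of h0 z] by (simp add: mult.commute[of "w z"] mult_left_mono)
    ultimately have "norm (f h z - f h0 z - (h - h0) *\<^sub>R f' h0 z) \<le> 2 * w z * \<bar>h - h0\<bar>"
      using norm_triangle_ineq4[of "f h z - f h0 z" "(h - h0) *\<^sub>R f' h0 z"] by simp
    then have "norm (f h z - f h0 z - (h - h0) *\<^sub>R f' h0 z) / \<bar>h - h0\<bar> \<le> 2 * w z"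
      using that by (simp add: pos_divide_le_eq)
    then show ?thesis
      unfolding q_def norm_scaleR diff_diff_eq by simp
  qed
  have "((\<lambda>h. integral\<^sup>L M (q h)) \<longlongrightarrow> 0) (at h0)"
    unfolding tendsto_at_iff_sequentially
  proof (intro allI impI)
    fix X assume X: "\<forall>i. X i \<in> UNIV - {h0}" "X \<longlonglongrightarrow> h0"
    have "(\<lambda>i. q (X i) z) \<longlonglongrightarrow> 0" for z
      using q_lim[of z] X unfolding tendsto_at_iff_sequentially comp_def by blast
    then have "(\<lambda>i. integral\<^sup>L M (q (X i))) \<longlonglongrightarrow> integral\<^sup>L M (\<lambda>_. 0 :: 'b)"
      by (intro integral_dominated_convergence[where w = "\<lambda>z. 2 * w z"])
        (use q_int q_bound X w in auto)
    then show "((\<lambda>h. integral\<^sup>L M (q h)) \<circ> X) \<longlonglongrightarrow> 0"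
      by (simp add: comp_def)
  qed
  moreover have "integral\<^sup>L M (q h) = (1 / norm (h - h0)) *\<^sub>R
      (integral\<^sup>L M (f h) - (integral\<^sup>L M (f h0) + (h - h0) *\<^sub>R integral\<^sup>L M (f' h0)))" for h
    unfolding q_def using int int' by simp
  ultimately show ?thesis
    unfolding has_vector_derivative_def has_derivative_within
    by (simp add: bounded_linear_scaleR_left)
qed

text \<open>There are finitely many lists of bounded length; summing the absolute values of their
  constants gives one nonnegative bound.\<close>

lemma schwartz_uniform_decay:
  fixes f :: "'a::euclidean_space \<Rightarrow> 'b::real_normed_vector"
  assumes "schwartz f"
  shows "\<exists>B\<ge>0. \<forall>bs. set bs \<subseteq> Basis \<and> length bs \<le> m \<longrightarrow>
    (\<forall>z. (1 + norm z) ^ k * norm (iterated_partial bs f z) \<le> B)"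
proof -
  let ?L = "{bs. set bs \<subseteq> (Basis :: 'a set) \<and> length bs \<le> m}"
  have fin: "finite ?L"
    by (rule finite_lists_length_le) simp
  have "\<forall>bs\<in>?L. \<exists>C. \<forall>z. (1 + norm z) ^ k * norm (iterated_partial bs f z) \<le> C"
    using assms unfolding schwartz_def by (simp add: in_lists_conv_set subset_iff)
  then obtain C where C: "\<forall>bs\<in>?L. \<forall>z. (1 + norm z) ^ k * norm (iterated_partial bs f z) \<le> C bs"
    by metis
  have "C bs \<le> (\<Sum>bs\<in>?L. \<bar>C bs\<bar>)" if "bs \<in> ?L" for bs
    using member_le_sum[OF that, of "\<lambda>bs. \<bar>C bs\<bar>"] fin by simp
  then show ?thesis
    using C by (intro exI[of _ "\<Sum>bs\<in>?L. \<bar>C bs\<bar>"]) (fastforce intro: sum_nonneg order_trans)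
qed

lemma schwartz_second_order_decay:
  fixes f :: "'a::euclidean_space \<Rightarrow> 'b::real_normed_vector"
  assumes "schwartz f"
  obtains B where "0 \<le> B"
    "\<And>z. norm (f z) \<le> B / (1 + norm z) ^ k \<and> (\<forall>b\<in>Basis. norm (partial_derivative b f z) \<le> B / (1 + norm z) ^ k \<and>
       (\<forall>c\<in>Basis. norm (partial_derivative c (partial_derivative b f) z) \<le> B / (1 + norm z) ^ k))"
proof -
  obtain B where B: "0 \<le> B" "\<And>bs z. set bs \<subseteq> Basis \<Longrightarrow> length bs \<le> 2 \<Longrightarrow>
      (1 + norm z) ^ k * norm (iterated_partial bs f z) \<le> B"
    using schwartz_uniform_decay[OF assms, of 2 k] by blast
  have pos: "0 < (1 + norm z) ^ k" for z :: 'a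
    by (simp add: add_pos_nonneg)
  have *: "norm (iterated_partial bs f z) \<le> B / (1 + norm z) ^ k" if "set bs \<subseteq> Basis" "length bs \<le> 2" for bs z
    using B(2)[OF that, of z] pos[of z] by (simp add: pos_le_divide_eq mult.commute)
  show ?thesis
    by (rule that[OF B(1)]) (use *[of "[]"] *[of "[_]"] *[of "[_, _]"] in auto)
qed

section \<open>The symmetrised integral without its normalising constant\<close>

definition heat_integral ::
    "real \<Rightarrow> ('a::euclidean_space \<times> real \<Rightarrow> 'b::{banach, second_countable_topology}) \<Rightarrow> 'a \<times> real \<Rightarrow> 'b"
  where "heat_integral a f X = (LINT Z|lborel. heat_kernel a Z *\<^sub>R second_difference f X Z)"

lemma continuous_on_second_difference:
  fixes f :: "'a::real_normed_vector \<times> real \<Rightarrow> 'b::real_normed_vector"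
  assumes "continuous_on UNIV f"
  shows "continuous_on UNIV (\<lambda>X. second_difference f X Z)" "continuous_on UNIV (second_difference f X)"
proof -
  show "continuous_on UNIV (\<lambda>X. second_difference f X Z)"
    unfolding second_difference_def
    by (intro continuous_intros continuous_on_compose2[OF assms]) auto
  show "continuous_on UNIV (second_difference f X)"
    unfolding second_difference_def[abs_def]
    by (intro continuous_intros continuous_on_compose2[OF assms]) auto
qed

lemma borel_measurable_heat_integrand:
  fixes f :: "'a::euclidean_space \<times> real \<Rightarrow> 'b::{banach, second_countable_topology}"
  assumes "continuous_on UNIV f"
  shows "(\<lambda>Z. heat_kernel a Z *\<^sub>R second_difference f X Z) \<in> borel_measurable lborel"
proof -
  have "second_difference f X \<in> borel_measurable borel"
    using continuous_on_second_difference(2)[OF assms] by (rule borel_measurable_continuous_onI)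
  then show ?thesis by simp
qed

text \<open>Boundedness of \<open>f\<close> and of its derivatives up to order two suffices, hence
  the exponent 0 in the decay. That \<open>M\<close> is chosen before \<open>X\<close> is the point:
  one majorant serves all base points.\<close>

lemma heat_integrand_bounded:
  fixes f :: "'a::euclidean_space \<times> real \<Rightarrow> 'b::real_normed_vector"
  assumes "schwartz f"
  obtains M where "\<And>X Z. norm (heat_kernel a Z *\<^sub>R second_difference f X Z) \<le> M * (heat_kernel a Z * min 1 ((norm (fst Z))\<^sup>2 + snd Z))"
proof -
  obtain B where B: "\<And>z. norm (f z) \<le> B / (1 + norm z) ^ 0 \<and> (\<forall>b\<in>Basis. norm (partial_derivative b f z) \<le> B / (1 + norm z) ^ 0 \<and>
       (\<forall>c\<in>Basis. norm (partial_derivative c (partial_derivative b f) z) \<le> B / (1 + norm z) ^ 0))"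
    using schwartz_second_order_decay[OF assms, of 0] by metis
  have f: "smooth f"
    using assms by (simp add: schwartz_def)
  show ?thesis
  proof
    fix X Z :: "'a \<times> real"
    obtain y r where Z: "Z = (y, r)" by fastforce
    show "norm (heat_kernel a Z *\<^sub>R second_difference f X Z)
      \<le> 4 * B * (real DIM('a) + 1)\<^sup>2 * (heat_kernel a Z * min 1 ((norm (fst Z))\<^sup>2 + snd Z))"
    proof (cases "0 < r")
      case True
      have "norm (second_difference f X (y, r)) \<le> 4 * B * (real DIM('a) + 1)\<^sup>2 * min 1 ((norm y)\<^sup>2 + r)"
        using f True B by (intro norm_second_difference_le) auto
      from mult_left_mono[OF this heat_kernel_nonneg[of a Z]] show ?thesis
        using heat_kernel_nonneg[of a Z] by (simp add: Z mult_ac)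
    qed (simp add: Z heat_kernel_def)
  qed
qed

context
  fixes s a :: real and f :: "'a::euclidean_space \<times> real \<Rightarrow> 'b::{banach, second_countable_topology}"
  assumes s: "0 < s" "s < 1" and a: "a = real DIM('a) / 2 + 1 + s" and f: "schwartz f"
begin

lemma integrable_heat_integrand:
  "integrable lborel (\<lambda>Z. heat_kernel a Z *\<^sub>R second_difference f X Z)"
proof -
  obtain M where M: "\<And>X Z. norm (heat_kernel a Z *\<^sub>R second_difference f X Z) \<le> M * (heat_kernel a Z * min 1 ((norm (fst Z))\<^sup>2 + snd Z))"
    using heat_integrand_bounded[OF f, of a] by blast
  show ?thesis
  proof (rule Bochner_Integration.integrable_bound)
    show "integrable lborel (\<lambda>Z::'a \<times> real. M * (heat_kernel a Z * min 1 ((norm (fst Z))\<^sup>2 + snd Z)))"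
      using integrable_heat_kernel_mult_min[OF s, where 'a = 'a] by (intro integrable_mult_right) (simp add: a)
    show "(\<lambda>Z. heat_kernel a Z *\<^sub>R second_difference f X Z) \<in> borel_measurable lborel"
      using f smooth_continuous borel_measurable_heat_integrand unfolding schwartz_def by blast
    show "AE Z in lborel. norm (heat_kernel a Z *\<^sub>R second_difference f X Z)
       \<le> norm (M * (heat_kernel a Z * min 1 ((norm (fst Z))\<^sup>2 + snd Z)))"
      unfolding real_norm_def by (intro AE_I2 order_trans[OF M abs_ge_self])
  qed
qed

lemma continuous_on_heat_integral: "continuous_on UNIV (heat_integral a f)"
proof -
  obtain M where M: "\<And>X Z. norm (heat_kernel a Z *\<^sub>R second_difference f X Z) \<le> M * (heat_kernel a Z * min 1 ((norm (fst Z))\<^sup>2 + snd Z))"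
    using heat_integrand_bounded[OF f, of a] by blast
  have cont: "continuous_on UNIV f"
    using f smooth_continuous unfolding schwartz_def by blast
  show ?thesis
    unfolding heat_integral_def[abs_def]
  proof (rule continuous_on_lebesgue_integral[OF _ _ _ M])
    show "(\<lambda>Z. heat_kernel a Z *\<^sub>R second_difference f X Z) \<in> borel_measurable lborel" for X
      using cont by (rule borel_measurable_heat_integrand)
    show "continuous_on UNIV (\<lambda>X. heat_kernel a Z *\<^sub>R second_difference f X Z)" for Z
      by (intro continuous_intros continuous_on_second_difference cont)
    show "integrable lborel (\<lambda>Z::'a \<times> real. M * (heat_kernel a Z * min 1 ((norm (fst Z))\<^sup>2 + snd Z)))"
      using integrable_heat_kernel_mult_min[OF s, where 'a = 'a] by (intro integrable_mult_right) (simp add: a)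
  qed
qed

end

text \<open>The second difference is linear in \<open>f\<close> and commutes with translation of
  \<open>X\<close>, so its derivative is the second difference of
  \<open>partial_derivative b f\<close>. That function is again Schwartz and supplies the
  majorant.\<close>

lemma has_vector_derivative_heat_integral:
  fixes f :: "'a::euclidean_space \<times> real \<Rightarrow> 'b::{banach, second_countable_topology}"
  assumes s: "0 < s" "s < 1" and a: "a = real DIM('a) / 2 + 1 + s" and f: "schwartz f" and b: "b \<in> Basis"
  shows "((\<lambda>h. heat_integral a f (X + h *\<^sub>R b)) has_vector_derivative heat_integral a (partial_derivative b f) X) (at 0)"
proof -
  let ?D = "partial_derivative b f"
  have D: "schwartz ?D"
    using f b by (rule schwartz_partial_derivative)
  have smooth: "smooth f" and D_cont: "continuous_on UNIV ?D"
    using f D smooth_continuous unfolding schwartz_def by blast+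
  obtain M where M: "\<And>X Z. norm (heat_kernel a Z *\<^sub>R second_difference ?D X Z) \<le> M * (heat_kernel a Z * min 1 ((norm (fst Z))\<^sup>2 + snd Z))"
    using heat_integrand_bounded[OF D, of a] by blast
  have "((\<lambda>h. heat_integral a f (X + h *\<^sub>R b)) has_vector_derivative heat_integral a ?D (X + 0 *\<^sub>R b)) (at 0)"
    unfolding heat_integral_def
  proof (rule has_vector_derivative_lebesgue_integral[OF _ _ _ _ M])
    show "integrable lborel (\<lambda>Z. heat_kernel a Z *\<^sub>R second_difference f (X + h *\<^sub>R b) Z)" for h
      by (rule integrable_heat_integrand[OF s a f])
    show "(\<lambda>Z. heat_kernel a Z *\<^sub>R second_difference ?D (X + 0 *\<^sub>R b) Z) \<in> borel_measurable lborel"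
      using D_cont by (rule borel_measurable_heat_integrand)
    show "integrable lborel (\<lambda>Z::'a \<times> real. M * (heat_kernel a Z * min 1 ((norm (fst Z))\<^sup>2 + snd Z)))"
      using integrable_heat_kernel_mult_min[OF s, where 'a = 'a] by (intro integrable_mult_right) (simp add: a)
    fix h Z
    have line: "((\<lambda>h. f (U + h *\<^sub>R b)) has_vector_derivative ?D (U + h *\<^sub>R b)) (at h)" for U
      using smooth_has_vector_derivative[OF smooth b] by (rule has_vector_derivative_along_line)
    have shift: "f (X + h *\<^sub>R b + W) = f (X + W + h *\<^sub>R b)" "?D (X + h *\<^sub>R b + W) = ?D (X + W + h *\<^sub>R b)" for h W
      by (simp_all add: add_ac)
    show "((\<lambda>h. heat_kernel a Z *\<^sub>R second_difference f (X + h *\<^sub>R b) Z) has_vector_derivative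
        heat_kernel a Z *\<^sub>R second_difference ?D (X + h *\<^sub>R b) Z) (at h)"
      unfolding second_difference_def shift
      by (intro bounded_linear.has_vector_derivative[OF bounded_linear_scaleR_right] has_vector_derivative_diff line)
  qed
  then show ?thesis by simp
qed

lemma schwartz_iterated_partial:
  "schwartz f \<Longrightarrow> set bs \<subseteq> Basis \<Longrightarrow> schwartz (iterated_partial bs f)"
  by (induction bs) (auto intro: schwartz_partial_derivative)

lemma smooth_heat_integral:
  fixes f :: "'a::euclidean_space \<times> real \<Rightarrow> 'b::{banach, second_countable_topology}"
  assumes s: "0 < s" "s < 1" and a: "a = real DIM('a) / 2 + 1 + s" and f: "schwartz f"
  shows "smooth (\<lambda>X. c *\<^sub>R heat_integral a f X)"
proof -
  have deriv: "((\<lambda>h. c *\<^sub>R heat_integral a (iterated_partial bs f) (X + h *\<^sub>R b)) has_vector_derivative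
      c *\<^sub>R heat_integral a (iterated_partial (b # bs) f) X) (at 0)" if "set bs \<subseteq> Basis" "b \<in> Basis" for bs b X
    using has_vector_derivative_heat_integral[OF s a schwartz_iterated_partial[OF f that(1)] that(2)]
    by (simp add: bounded_linear.has_vector_derivative[OF bounded_linear_scaleR_right])
  \<comment> \<open>An identity of functions, not of values at one point, since the next partial
    derivative acts on the whole function.\<close>
  have eq: "iterated_partial bs (\<lambda>X. c *\<^sub>R heat_integral a f X) = (\<lambda>X. c *\<^sub>R heat_integral a (iterated_partial bs f) X)"
    if "set bs \<subseteq> Basis" for bs
    using that
  proof (induction bs)
    case (Cons b bs)
    then have IH: "iterated_partial bs (\<lambda>X. c *\<^sub>R heat_integral a f X) = (\<lambda>X. c *\<^sub>R heat_integral a (iterated_partial bs f) X)"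
      by simp
    show ?case
      unfolding iterated_partial.simps(2)[of b bs "\<lambda>X. c *\<^sub>R heat_integral a f X"] IH partial_derivative_def[abs_def]
      using deriv[of bs b] Cons.prems by (intro ext vector_derivative_at) auto
  qed simp
  show ?thesis
    unfolding smooth_def
  proof (intro ballI conjI allI)
    fix bs :: "('a \<times> real) list" assume "bs \<in> lists Basis"
    then have bs: "set bs \<subseteq> Basis" by auto
    show "continuous_on UNIV (iterated_partial bs (\<lambda>X. c *\<^sub>R heat_integral a f X))"
      unfolding eq[OF bs]
      using continuous_on_heat_integral[OF s a schwartz_iterated_partial[OF f bs]] by (intro continuous_intros)
    fix b z :: "'a \<times> real" assume "b \<in> Basis"
    from deriv[OF bs this, of z]
    show "(\<lambda>h::real. iterated_partial bs (\<lambda>X. c *\<^sub>R heat_integral a f X) (z + h *\<^sub>R b)) differentiable at 0"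
      unfolding eq[OF bs] by (rule differentiableI_vector)
  qed
qed

section \<open>Decay\<close>

definition parabolic_weight :: "'a::real_normed_vector \<times> real \<Rightarrow> real"
  where "parabolic_weight X = 1 + (norm (fst X))\<^sup>2 + \<bar>snd X\<bar>"

lemma parabolic_weight_ge_1: "1 \<le> parabolic_weight X"
  by (simp add: parabolic_weight_def)

lemma parabolic_weight_le: "parabolic_weight X \<le> (1 + norm X)\<^sup>2"
proof -
  have "norm (fst X) \<le> norm X" "\<bar>snd X\<bar> \<le> norm X"
    using norm_fst_le[of "fst X" "snd X"] norm_snd_le[of "snd X" "fst X"] by simp_all
  moreover from this(1) have "(norm (fst X))\<^sup>2 \<le> (norm X)\<^sup>2"
    by (intro power_mono) auto
  ultimately have "parabolic_weight X \<le> 1 + (norm X)\<^sup>2 + 2 * norm X"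
    unfolding parabolic_weight_def using norm_ge_zero[of X] by linarith
  then show ?thesis
    by (simp add: power2_sum)
qed

text \<open>From |x|^2 <= 2 |u|^2 + 2 \<rho>^2, with u the spatial part of \<open>U\<close>, the
  weight at \<open>X\<close> is at most twice the weight at \<open>U\<close> plus 2 (\<rho>^2 + r).
  The threshold 1/4 makes the last term at most half the weight at \<open>X\<close>, which is
  absorbed on the left.\<close>

lemma parabolic_weight_nearby:
  assumes U: "norm (fst U - fst X) \<le> \<rho>" "\<bar>snd U - snd X\<bar> \<le> r"
    and near: "\<rho>\<^sup>2 + r \<le> parabolic_weight X / 4"
  shows "parabolic_weight X \<le> 4 * parabolic_weight U"
proof -
  have "norm (fst X) \<le> norm (fst U) + \<rho>"
    using U(1) norm_triangle_ineq2[of "fst X" "fst U"] by (simp add: norm_minus_commute)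
  then have "(norm (fst X))\<^sup>2 \<le> (norm (fst U) + \<rho>)\<^sup>2"
    by (intro power_mono) auto
  also have "\<dots> \<le> 2 * (norm (fst U))\<^sup>2 + 2 * \<rho>\<^sup>2"
    using zero_le_power2[of "norm (fst U) - \<rho>"] by (simp add: power2_sum power2_diff)
  finally have "(norm (fst X))\<^sup>2 \<le> 2 * (norm (fst U))\<^sup>2 + 2 * \<rho>\<^sup>2" .
  moreover have "\<bar>snd X\<bar> \<le> \<bar>snd U\<bar> + r" "0 \<le> r"
    using U(2) by linarith+
  moreover have "2 * \<rho>\<^sup>2 + 2 * r \<le> parabolic_weight X / 2"
    using near by simp
  ultimately show ?thesis
    using zero_le_power2[of "norm (fst U)"] unfolding parabolic_weight_def by (simp add: field_simps)
qed

definition Cauchy_weight :: "'a::euclidean_space \<Rightarrow> real"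
  where "Cauchy_weight z = (\<Prod>b\<in>Basis. 1 / (1 + (z \<bullet> b)\<^sup>2))"

text \<open>Each coordinate factor is at most (1 + |z|)^2, so two powers of decay per dimension
  reach an integrable majorant.\<close>

lemma inverse_power_le_Cauchy_weight:
  fixes z :: "'a::euclidean_space"
  assumes "2 * DIM('a) \<le> k"
  shows "1 / (1 + norm z) ^ k \<le> Cauchy_weight z"
proof -
  have pos: "0 < (\<Prod>b\<in>Basis. 1 + (z \<bullet> b)\<^sup>2)"
    by (intro prod_pos) (simp add: add_pos_nonneg)
  have "(\<Prod>b\<in>Basis. 1 + (z \<bullet> b)\<^sup>2) \<le> (1 + (norm z)\<^sup>2) ^ DIM('a)"
    using prod_one_plus_le_power[of 1 z] by simp
  also have "\<dots> \<le> ((1 + norm z)\<^sup>2) ^ DIM('a)"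
    by (intro power_mono) (auto simp: power2_sum)
  also have "\<dots> \<le> (1 + norm z) ^ k"
    using assms by (simp add: power_mult[symmetric] power_increasing)
  finally have "1 / (1 + norm z) ^ k \<le> 1 / (\<Prod>b\<in>Basis. 1 + (z \<bullet> b)\<^sup>2)"
    using pos by (intro divide_left_mono mult_pos_pos) (auto intro!: zero_less_power add_pos_nonneg)
  then show ?thesis
    by (simp add: Cauchy_weight_def prod_dividef)
qed

lemma inverse_power_le_parabolic_weight:
  assumes "0 \<le> a" "2 * a \<le> real k"
  shows "1 / (1 + norm z) ^ k \<le> parabolic_weight z powr (- a)"
proof -
  have W: "1 \<le> parabolic_weight z" by (rule parabolic_weight_ge_1)
  have "parabolic_weight z powr a \<le> ((1 + norm z)\<^sup>2) powr a"
    using parabolic_weight_le[of z] W assms by (intro powr_mono2) auto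
  also have "\<dots> = (1 + norm z) powr (2 * a)"
    by (simp add: powr_powr flip: powr_numeral)
  also have "\<dots> \<le> (1 + norm z) powr real k"
    using assms by (intro powr_mono) auto
  also have "\<dots> = (1 + norm z) ^ k"
    by (simp add: powr_realpow add_pos_nonneg)
  finally have "1 / (1 + norm z) ^ k \<le> 1 / parabolic_weight z powr a"
    using W by (intro divide_left_mono mult_pos_pos) (auto intro!: zero_less_power add_pos_nonneg)
  then show ?thesis
    by (simp add: powr_minus_divide)
qed

lemma integrable_distr_lborel:
  fixes g :: "'a::euclidean_space \<Rightarrow> 'b::{banach, second_countable_topology}"
  assumes "distr lborel borel T = lborel" "T \<in> borel_measurable borel" "integrable lborel g"
  shows "integrable lborel (\<lambda>z. g (T z))" "(LINT z|lborel. g (T z)) = integral\<^sup>L lborel g"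
proof -
  have T: "T \<in> lborel \<rightarrow>\<^sub>M borel" and g: "g \<in> borel_measurable borel"
    using assms(2) borel_measurable_integrable[OF assms(3)] by auto
  show "integrable lborel (\<lambda>z. g (T z))"
    using integrable_distr_eq[OF T g] assms(1,3) by simp
  show "(LINT z|lborel. g (T z)) = integral\<^sup>L lborel g"
    using integral_distr[OF T g] assms(1) by simp
qed

lemma heat_integral_decay:
  fixes f :: "'a::euclidean_space \<times> real \<Rightarrow> 'b::{banach, second_countable_topology}"
  assumes s: "0 < s" "s < 1" and a: "a = real DIM('a) / 2 + 1 + s" and f: "schwartz f"
  shows "\<exists>C\<ge>0. \<forall>X. norm (heat_integral a f X) \<le> C * parabolic_weight X powr (- a)"
proof -
  \<comment> \<open>The first summand secures decay of order a in the parabolic weight, the second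
    integrability over space-time.\<close>
  define k where "k = nat \<lceil>2 * a\<rceil> + 2 * DIM('a \<times> real)"
  have a1: "1 \<le> a" using s a by simp
  have k: "2 * a \<le> real k" "2 * DIM('a \<times> real) \<le> k"
    unfolding k_def by linarith+
  obtain B where B: "0 \<le> B"
    "\<And>z. norm (f z) \<le> B / (1 + norm z) ^ k \<and> (\<forall>b\<in>Basis. norm (partial_derivative b f z) \<le> B / (1 + norm z) ^ k \<and>
       (\<forall>c\<in>Basis. norm (partial_derivative c (partial_derivative b f) z) \<le> B / (1 + norm z) ^ k))"
    using schwartz_second_order_decay[OF f, of k] by metis
  have smooth: "smooth f"
    using f by (simp add: schwartz_def)
  have decay: "B / (1 + norm z) ^ k \<le> B * parabolic_weight z powr (- a)" for z :: "'a \<times> real"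
    using mult_left_mono[OF inverse_power_le_parabolic_weight B(1), of a k z] a1 k by simp
  have f_Cauchy: "norm (f z) \<le> B * Cauchy_weight z" for z
    using mult_left_mono[OF inverse_power_le_Cauchy_weight[OF k(2)] B(1), of z] B(2)[of z] by simp
  let ?m = "\<lambda>Z :: 'a \<times> real. heat_kernel a Z * min 1 ((norm (fst Z))\<^sup>2 + snd Z)"
  let ?g = "\<lambda>X Z :: 'a \<times> real. Cauchy_weight (X + Z) + Cauchy_weight (X + (- fst Z, snd Z))"
  \<comment> \<open>The first summand of \<open>K1\<close> comes from the near region, with
    \<open>4 powr a\<close> from comparing weights there; \<open>8 * B\<close> comes from the term 2
    f(X) in the far region. \<open>K2\<close> multiplies the far kernel bound by the size of
    \<open>f\<close>.\<close>
  define K1 where "K1 = 4 * (B * 4 powr a) * (real DIM('a) + 1)\<^sup>2 + 8 * B"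
  define K2 where "K2 = (4 * a) powr a * 4 powr a * B"
  have K: "0 \<le> K1" "0 \<le> K2"
    using B(1) by (auto simp: K1_def K2_def)
  have g_nonneg: "0 \<le> Cauchy_weight z" for z :: "'a \<times> real"
    by (auto simp: Cauchy_weight_def intro: prod_nonneg)
  have pointwise: "norm (heat_kernel a Z *\<^sub>R second_difference f X Z)
      \<le> parabolic_weight X powr (- a) * (K1 * ?m Z + K2 * ?g X Z)" for X Z
  proof (cases "0 < snd Z")
    case False
    then show ?thesis
      using K g_nonneg by (simp add: heat_kernel_def)
  next
    case True
    obtain y r where Z: "Z = (y, r)" by fastforce
    have r: "0 < r" using True Z by simp
    let ?W = "parabolic_weight X powr (- a)"
    have W1: "1 \<le> parabolic_weight X" by (rule parabolic_weight_ge_1)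
    have quarter: "(parabolic_weight X / 4) powr (- a) = 4 powr a * ?W"
      using W1 by (simp add: powr_divide powr_minus_divide)
    have m_nonneg: "0 \<le> ?m Z"
      using heat_kernel_nonneg[of a Z] r by (simp add: Z)
    show ?thesis
    proof (cases "(norm y)\<^sup>2 + r \<le> parabolic_weight X / 4")
      case near: True
      have M: "B / (1 + norm U) ^ k \<le> B * (4 powr a * ?W)"
        if "norm (fst U - fst X) \<le> norm y" "\<bar>snd U - snd X\<bar> \<le> r" for U
      proof -
        have "parabolic_weight X / 4 \<le> parabolic_weight U"
          using parabolic_weight_nearby[OF that near] by simp
        then have "parabolic_weight U powr (- a) \<le> (parabolic_weight X / 4) powr (- a)"
          using W1 a1 by (intro powr_mono2') auto
        then show ?thesis
          using decay[of U] B(1) unfolding quarter by (meson mult_left_mono order_trans)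
      qed
      have "norm (second_difference f X (y, r))
        \<le> 4 * (B * (4 powr a * ?W)) * (real DIM('a) + 1)\<^sup>2 * min 1 ((norm y)\<^sup>2 + r)"
        using smooth less_imp_le[OF r] by (rule norm_second_difference_le) (use B(2) M order_trans in blast)
      from mult_left_mono[OF this heat_kernel_nonneg[of a Z]]
      have "norm (heat_kernel a Z *\<^sub>R second_difference f X Z)
        \<le> ?W * ((4 * (B * 4 powr a) * (real DIM('a) + 1)\<^sup>2) * ?m Z)"
        using heat_kernel_nonneg[of a Z] by (simp add: Z mult_ac)
      also have "\<dots> \<le> ?W * (K1 * ?m Z + K2 * ?g X Z)"
        using m_nonneg B(1) K g_nonneg
        by (intro mult_left_mono add_increasing2 mult_right_mono) (auto simp: K1_def)
      finally show ?thesis .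
    next
      case far: False
      have "heat_kernel a Z \<le> (4 * a) powr a * ((norm y)\<^sup>2 + r) powr (- a)"
        unfolding Z using r a1 by (intro heat_kernel_le) auto
      also have "((norm y)\<^sup>2 + r) powr (- a) \<le> (parabolic_weight X / 4) powr (- a)"
        using far W1 a1 by (intro powr_mono2') auto
      finally have kernel: "heat_kernel a Z \<le> (4 * a) powr a * (4 powr a * ?W)"
        unfolding quarter by (simp add: mult_left_mono)
      \<comment> \<open>Far means |y|^2 + r > W/4 >= 1/4, so the bare kernel is dominated by the
        integrable function \<open>?m\<close>.\<close>
      have "1 \<le> 4 * min 1 ((norm y)\<^sup>2 + r)"
        using far W1 by (simp add: min_def)
      from mult_left_mono[OF this heat_kernel_nonneg[of a Z]]
      have k_le: "heat_kernel a Z \<le> 4 * ?m Z"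
        by (simp add: Z)
      have fX: "norm (f X) \<le> B * ?W"
        using B(2)[of X] decay[of X] by linarith
      have "norm (second_difference f X Z)
        \<le> 2 * norm (f X) + norm (f (X + Z)) + norm (f (X + (- fst Z, snd Z)))"
        unfolding second_difference_def
        using norm_triangle_ineq4[of "2 *\<^sub>R f X - f (X + Z)" "f (X + (- fst Z, snd Z))"]
          norm_triangle_ineq4[of "2 *\<^sub>R f X" "f (X + Z)"] by simp
      also have "\<dots> \<le> 2 * (B * ?W) + B * ?g X Z"
        using fX f_Cauchy[of "X + Z"] f_Cauchy[of "X + (- fst Z, snd Z)"] by (simp add: distrib_left)
      finally have "norm (second_difference f X Z) \<le> 2 * (B * ?W) + B * ?g X Z" .
      from mult_left_mono[OF this heat_kernel_nonneg[of a Z]]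
      have "norm (heat_kernel a Z *\<^sub>R second_difference f X Z)
        \<le> heat_kernel a Z * (2 * (B * ?W)) + heat_kernel a Z * (B * ?g X Z)"
        using heat_kernel_nonneg[of a Z] by (simp add: distrib_left)
      \<comment> \<open>The terms are treated in opposite ways. The value at \<open>X\<close> is
        constant in \<open>Z\<close>: it decays itself and the kernel is integrated. For the two
        shifted values the kernel supplies the decay and \<open>f\<close> the integrability.\<close>
      also have "\<dots> \<le> (4 * ?m Z) * (2 * (B * ?W)) + ((4 * a) powr a * (4 powr a * ?W)) * (B * ?g X Z)"
        using k_le kernel B(1) g_nonneg by (intro add_mono mult_right_mono) auto
      also have "\<dots> = ?W * ((8 * B) * ?m Z + K2 * ?g X Z)"
        by (simp add: K2_def algebra_simps)
      also have "\<dots> \<le> ?W * (K1 * ?m Z + K2 * ?g X Z)"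
        using m_nonneg B(1) by (intro mult_left_mono add_right_mono mult_right_mono) (auto simp: K1_def)
      finally show ?thesis .
    qed
  qed
  have m_int: "integrable lborel ?m"
    using integrable_heat_kernel_mult_min[OF s, where 'a = 'a] by (simp add: a)
  have Cauchy_int: "integrable lborel (Cauchy_weight :: 'a \<times> real \<Rightarrow> real)"
    unfolding Cauchy_weight_def[abs_def] by (rule integrable_Cauchy_weight)
  define G where "G = integral\<^sup>L lborel (Cauchy_weight :: 'a \<times> real \<Rightarrow> real)"
  \<comment> \<open>The integrals of the moved weights do not depend on \<open>X\<close>, which
    keeps the final constant uniform.\<close>
  have shift: "integrable lborel (\<lambda>Z. Cauchy_weight (X + Z))" "(LINT Z|lborel. Cauchy_weight (X + Z)) = G"
    for X :: "'a \<times> real"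
    using integrable_distr_lborel[OF lborel_distr_sign_affine[of 1 X] _ Cauchy_int] by (simp_all add: G_def)
  have "(\<lambda>Z. X + (- fst Z, snd Z)) \<in> borel_measurable borel" for X :: "'a \<times> real"
    by (intro borel_measurable_continuous_onI continuous_intros)
  then have reflect: "integrable lborel (\<lambda>Z. Cauchy_weight (X + (- fst Z, snd Z)))"
    "(LINT Z|lborel. Cauchy_weight (X + (- fst Z, snd Z))) = G" for X :: "'a \<times> real"
    using integrable_distr_lborel[OF lborel_distr_reflect_fst _ Cauchy_int] by (simp_all add: G_def)
  define I where "I = integral\<^sup>L lborel ?m"
  have "norm (heat_integral a f X) \<le> (K1 * I + K2 * (G + G)) * parabolic_weight X powr (- a)" for X
  proof -
    have int: "integrable lborel (\<lambda>Z. parabolic_weight X powr (- a) * (K1 * ?m Z + K2 * ?g X Z))"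
      using m_int shift(1)[of X] reflect(1)[of X] by simp
    have "norm (heat_integral a f X) \<le> (LINT Z|lborel. norm (heat_kernel a Z *\<^sub>R second_difference f X Z))"
      unfolding heat_integral_def by (rule integral_norm_bound)
    also have "\<dots> \<le> (LINT Z|lborel. parabolic_weight X powr (- a) * (K1 * ?m Z + K2 * ?g X Z))"
      using integrable_heat_integrand[OF s a f, of X] int pointwise
      by (intro integral_mono) (auto simp del: norm_scaleR)
    also have "\<dots> = parabolic_weight X powr (- a) * (K1 * I + K2 * (G + G))"
      using m_int shift[of X] reflect[of X] by (simp add: I_def)
    finally show ?thesis
      by (simp add: mult.commute)
  qed
  moreover have "0 \<le> I" unfolding I_def
    by (rule integral_nonneg_AE) (auto simp: heat_kernel_def)
  moreover have "0 \<le> G" unfolding G_def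
    using g_nonneg by (intro integral_nonneg_AE) auto
  ultimately show ?thesis
    using K by (intro exI[of _ "K1 * I + K2 * (G + G)"]) auto
qed

section \<open>Principal value and symmetrisation\<close>

text \<open>Dominated convergence with majorant \<open>norm (f y)\<close>: shrinking the removed
  ball exhausts everything except the null set {x}.\<close>

lemma pv_integral_eq_integral:
  fixes f :: "'a::euclidean_space \<Rightarrow> 'b::{banach, second_countable_topology}"
  assumes f: "integrable lborel f"
  shows "pv_integral x f = integral\<^sup>L lborel f"
  unfolding pv_integral_def
proof (rule tendsto_Lim)
  show "((\<lambda>\<epsilon>. LINT y:{y. dist x y > \<epsilon>}|lborel. f y) \<longlongrightarrow> integral\<^sup>L lborel f) (at_right 0)"
  proof (rule tendsto_at_right_sequentially[OF zero_less_one])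
    fix S :: "nat \<Rightarrow> real" assume S: "\<And>n. 0 < S n" "S \<longlonglongrightarrow> 0"
    have open_far: "open {y. dist x y > \<epsilon>}" for \<epsilon>
      by (intro open_Collect_less continuous_intros)
    have meas: "(\<lambda>y. indicator {y. dist x y > \<epsilon>} y *\<^sub>R f y) \<in> borel_measurable lborel" for \<epsilon>
      using f borel_measurable_integrable[OF f] open_far[of \<epsilon>] by (intro borel_measurable_scaleR borel_measurable_indicator) auto
    show "(\<lambda>n. LINT y:{y. dist x y > S n}|lborel. f y) \<longlonglongrightarrow> integral\<^sup>L lborel f"
      unfolding set_lebesgue_integral_def
    proof (rule integral_dominated_convergence[where w = "\<lambda>y. norm (f y)"])
      show "AE y in lborel. (\<lambda>n. indicator {y. dist x y > S n} y *\<^sub>R f y) \<longlonglongrightarrow> f y"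
        using AE_lborel_singleton[of x]
      proof eventually_elim
        case (elim y)
        then have "0 < dist x y" by simp
        then have "\<forall>\<^sub>F n in sequentially. S n < dist x y"
          using S(2) order_tendstoD(2) by blast
        then have "\<forall>\<^sub>F n in sequentially. indicator {y. dist x y > S n} y *\<^sub>R f y = f y"
          by eventually_elim simp
        then show ?case by (rule tendsto_eventually)
      qed
    qed (use f meas in \<open>auto simp: indicator_def\<close>)
  qed
qed simp

text \<open>Since |y|^2 + r >= r, the minimum in \<open>heat_kernel_mult_min_le\<close> is at least
  the positive number \<open>min 1 r\<close>, by which one may divide at fixed r.\<close>

lemma integrable_heat_kernel_slice:
  assumes r: "0 < r"
  shows "integrable lborel (\<lambda>y::'a::euclidean_space. heat_kernel a (y, r))"
proof -
  have min_pos: "min 1 r \<noteq> 0"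
    using r by auto
  define C where "C = (4 * (real DIM('a) + 1)) ^ (DIM('a) + 1) * (min 1 r * r powr (- a)) / min 1 r"
  have slice_meas: "(\<lambda>y::'a. heat_kernel a (y, r)) \<in> borel_measurable lborel"
  proof -
    have "(\<lambda>y::'a. heat_kernel a (y, r)) \<in> borel_measurable borel"
      unfolding heat_kernel_eq[OF r] using r
      by (intro borel_measurable_continuous_onI continuous_intros) auto
    then show ?thesis by simp
  qed
  have prod_nonneg': "0 \<le> (\<Prod>b\<in>Basis. 1 / (1 + (y \<bullet> b)\<^sup>2 / r))" for y :: 'a
    using r by (intro prod_nonneg) auto
  have "integrable lborel (\<lambda>y::'a. \<Prod>b\<in>Basis. 1 / (1 + (y \<bullet> b)\<^sup>2 / r))"
    using nn_integral_scaled_Cauchy_weight[OF r, where 'a = 'a] prod_nonneg'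
    by (intro integrableI_nonneg) auto
  then have "integrable lborel (\<lambda>y::'a. C * (\<Prod>b\<in>Basis. 1 / (1 + (y \<bullet> b)\<^sup>2 / r)))"
    by (rule integrable_mult_right)
  then show ?thesis
  proof (rule Bochner_Integration.integrable_bound[OF _ slice_meas], intro AE_I2)
    fix y :: 'a
    have "heat_kernel a (y, r) * min 1 r \<le> heat_kernel a (y, r) * min 1 ((norm y)\<^sup>2 + r)"
      using heat_kernel_nonneg by (intro mult_left_mono min.mono) auto
    also note heat_kernel_mult_min_le[OF r]
    finally have "heat_kernel a (y, r) \<le> C * (\<Prod>b\<in>Basis. 1 / (1 + (y \<bullet> b)\<^sup>2 / r))"
      using r min_pos unfolding C_def by (simp add: pos_le_divide_eq)
    then show "norm (heat_kernel a (y, r)) \<le> norm (C * (\<Prod>b\<in>Basis. 1 / (1 + (y \<bullet> b)\<^sup>2 / r)))"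
      using heat_kernel_nonneg[of a "(y, r)"] by simp
  qed
qed

text \<open>At fixed r > 0 the kernel is integrable and \<open>f\<close> bounded, so the original
  integrand \<open>g\<close> is integrable. The substitutions x + y and x - y each preserve its
  integral, and their sum is the second difference because the kernel is even in y; hence the factor
  1/2.\<close>

lemma pv_integral_heat_kernel:
  fixes f :: "'a::euclidean_space \<times> real \<Rightarrow> 'b::{banach, second_countable_topology}"
  assumes f: "schwartz f" and r: "0 < r"
  shows "pv_integral x (\<lambda>y. heat_kernel a (x - y, r) *\<^sub>R (f (x, t) - f (y, t + r)))
    = (1 / 2) *\<^sub>R (LINT y|lborel. heat_kernel a (y, r) *\<^sub>R second_difference f (x, t) (y, r))"
proof -
  define g where "g y = heat_kernel a (x - y, r) *\<^sub>R (f (x, t) - f (y, t + r))" for y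
  obtain B where B: "\<And>z. norm (f z) \<le> B"
    using schwartz_second_order_decay[OF f, of 0] by (metis div_by_1 power_0)
  have cont: "continuous_on UNIV f"
    using f smooth_continuous unfolding schwartz_def by blast
  have "(\<lambda>y. x + (- 1) *\<^sub>R y) \<in> borel_measurable borel"
    by (intro borel_measurable_continuous_onI continuous_intros)
  from integrable_distr_lborel(1)[OF lborel_distr_sign_affine this integrable_heat_kernel_slice[OF r, of a]]
  have ker: "integrable lborel (\<lambda>y. heat_kernel a (x - y, r))"
    by simp
  have g_int: "integrable lborel g"
  proof (rule Bochner_Integration.integrable_bound)
    show "integrable lborel (\<lambda>y. heat_kernel a (x - y, r) * (2 * B))"
      using ker by simp
    have "(\<lambda>y. f (x, t) - f (y, t + r)) \<in> borel_measurable borel"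
      by (intro borel_measurable_continuous_onI continuous_intros continuous_on_compose2[OF cont]) auto
    then show "g \<in> borel_measurable lborel"
      unfolding g_def[abs_def] using borel_measurable_integrable[OF ker] by (intro borel_measurable_scaleR) auto
    show "AE y in lborel. norm (g y) \<le> norm (heat_kernel a (x - y, r) * (2 * B))"
    proof (rule AE_I2)
      fix y
      have "norm (f (x, t) - f (y, t + r)) \<le> 2 * B"
        using norm_triangle_ineq4[of "f (x, t)" "f (y, t + r)"] B[of "(x, t)"] B[of "(y, t + r)"] by linarith
      then have "norm (g y) \<le> heat_kernel a (x - y, r) * (2 * B)"
        using heat_kernel_nonneg[of a "(x - y, r)"] by (simp add: g_def mult_left_mono)
      also have "\<dots> \<le> norm (heat_kernel a (x - y, r) * (2 * B))"
        by simp
      finally show "norm (g y) \<le> norm (heat_kernel a (x - y, r) * (2 * B))" .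
    qed
  qed
  have affine: "(\<lambda>y. x + c *\<^sub>R y) \<in> borel_measurable borel" for c
    by (intro borel_measurable_continuous_onI continuous_intros)
  have plus: "integrable lborel (\<lambda>y. g (x + 1 *\<^sub>R y))" "(LINT y|lborel. g (x + 1 *\<^sub>R y)) = integral\<^sup>L lborel g"
    by (rule integrable_distr_lborel[OF lborel_distr_sign_affine affine g_int]; simp)+
  have minus: "integrable lborel (\<lambda>y. g (x + (- 1) *\<^sub>R y))" "(LINT y|lborel. g (x + (- 1) *\<^sub>R y)) = integral\<^sup>L lborel g"
    by (rule integrable_distr_lborel[OF lborel_distr_sign_affine affine g_int]; simp)+
  have "heat_kernel a (y, r) *\<^sub>R second_difference f (x, t) (y, r) = g (x + 1 *\<^sub>R y) + g (x + (- 1) *\<^sub>R y)" for y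
    by (simp add: g_def second_difference_def heat_kernel_def scaleR_2 algebra_simps)
  then have "(LINT y|lborel. heat_kernel a (y, r) *\<^sub>R second_difference f (x, t) (y, r))
    = (LINT y|lborel. g (x + 1 *\<^sub>R y)) + (LINT y|lborel. g (x + (- 1) *\<^sub>R y))"
    using Bochner_Integration.integral_add[OF plus(1) minus(1)] by simp
  also have "\<dots> = 2 *\<^sub>R integral\<^sup>L lborel g"
    unfolding plus(2) minus(2) by (simp add: scaleR_2)
  finally show ?thesis
    using pv_integral_eq_integral[OF g_int, of x] by (simp add: g_def[abs_def])
qed

lemma frac_heat_right_eq_heat_integral:
  fixes \<phi> :: "(real ^ 'n) \<times> real \<Rightarrow> 'b::{banach, second_countable_topology}"
  assumes s: "0 < s" "s < 1" and a: "a = real CARD('n) / 2 + 1 + s" and \<phi>: "schwartz \<phi>"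
  shows "frac_heat_right s \<phi> X = (heat_const CARD('n) s / 2) *\<^sub>R heat_integral a \<phi> X"
proof -
  obtain x t where X: "X = (x, t)" by fastforce
  define h where "h y r = heat_kernel a (y, r) *\<^sub>R second_difference \<phi> X (y, r)" for y r
  have "integrable lborel (\<lambda>Z. heat_kernel a Z *\<^sub>R second_difference \<phi> X Z)"
    using a by (intro integrable_heat_integrand[OF s _ \<phi>]) simp
  then have h_int: "integrable (lborel \<Otimes>\<^sub>M lborel) (case_prod h)"
    by (simp add: lborel_prod h_def[abs_def] case_prod_unfold)
  \<comment> \<open>Integrability of \<open>A\<close> in time comes from \<open>h_int\<close>, the
    absolute integrability of the symmetrised integrand.\<close>
  define A where "A r = (LINT y|lborel. h y r)" for r
  have A_int: "integrable lborel A"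
    unfolding A_def[abs_def] using h_int by (rule lborel_pair.integrable_snd)
  have A_0: "A r = 0" if "r \<le> 0" for r
    using that by (simp add: A_def h_def heat_kernel_def)
  \<comment> \<open>Only t < \<tau> is needed: elsewhere the indicator annihilates the principal
    value, whatever its value.\<close>
  have slice: "pv_integral x (\<lambda>y. (exp (- ((norm (x - y))\<^sup>2 / (4 * (\<tau> - t)))) / (\<tau> - t) powr (real CARD('n) / 2 + 1 + s))
       *\<^sub>R (\<phi> (x, t) - \<phi> (y, \<tau>))) = (1 / 2) *\<^sub>R A (\<tau> - t)" if "t < \<tau>" for \<tau>
    using pv_integral_heat_kernel[OF \<phi>, of "\<tau> - t" x a t] that
    by (simp add: heat_kernel_def a A_def h_def X)
  have "frac_heat_right s \<phi> X = heat_const CARD('n) s *\<^sub>R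
      (LINT \<tau>|lborel. indicator {t<..} \<tau> *\<^sub>R ((1 / 2) *\<^sub>R A (\<tau> - t)))"
    unfolding frac_heat_right_def X prod.case set_lebesgue_integral_def
  proof (rule arg_cong[where f = "scaleR _"], rule Bochner_Integration.integral_cong[OF refl])
    fix \<tau>
    show "indicator {t<..} \<tau> *\<^sub>R pv_integral x
        (\<lambda>y. (exp (- ((norm (x - y))\<^sup>2 / (4 * (\<tau> - t)))) / (\<tau> - t) powr (real CARD('n) / 2 + 1 + s))
           *\<^sub>R (\<phi> (x, t) - \<phi> (y, \<tau>)))
      = indicator {t<..} \<tau> *\<^sub>R ((1 / 2) *\<^sub>R A (\<tau> - t))"
      by (cases "t < \<tau>") (simp_all only: slice, simp)
  qed
  also have "(LINT \<tau>|lborel. indicator {t<..} \<tau> *\<^sub>R ((1 / 2) *\<^sub>R A (\<tau> - t)))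
    = (LINT \<tau>|lborel. (1 / 2) *\<^sub>R A (- t + 1 *\<^sub>R \<tau>))"
  proof (rule Bochner_Integration.integral_cong[OF refl])
    fix \<tau>
    show "indicator {t<..} \<tau> *\<^sub>R ((1 / 2) *\<^sub>R A (\<tau> - t)) = (1 / 2) *\<^sub>R A (- t + 1 *\<^sub>R \<tau>)"
      by (cases "t < \<tau>") (simp_all add: A_0)
  qed
  also have "\<dots> = (1 / 2) *\<^sub>R (LINT \<tau>|lborel. A (- t + 1 *\<^sub>R \<tau>))"
    by (rule integral_scaleR_right)
  also have "(LINT \<tau>|lborel. A (- t + 1 *\<^sub>R \<tau>)) = integral\<^sup>L lborel A"
    by (rule integrable_distr_lborel(2)[OF lborel_distr_sign_affine _ A_int]) auto
  also have "integral\<^sup>L lborel A = heat_integral a \<phi> X"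
    unfolding A_def[abs_def] lborel_pair.integral_snd[OF h_int] heat_integral_def
    by (simp add: lborel_prod h_def[abs_def] case_prod_unfold)
  finally show ?thesis by simp
qed

theorem lemma1p2:
  fixes \<phi> :: "(real ^ 'n) \<times> real \<Rightarrow> complex" and s :: real
  assumes "0 < s" and "s < 1"
    and "schwartz \<phi>"
  shows "smooth (frac_heat_right s \<phi>) \<and>
    (\<exists>C>0. \<forall>(x :: real ^ 'n) (t :: real).
       norm (frac_heat_right s \<phi> (x, t))
         \<le> C / (1 + norm x powr (real CARD('n) + 2 + 2 * s)
                  + \<bar>t\<bar> powr (real CARD('n) / 2 + 1 + s)))"
proof
  define a where "a = real CARD('n) / 2 + 1 + s"
  define c where "c = heat_const CARD('n) s / 2"
  have eq: "frac_heat_right s \<phi> = (\<lambda>X. c *\<^sub>R heat_integral a \<phi> X)"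
    using frac_heat_right_eq_heat_integral[OF assms(1,2) a_def assms(3)] by (auto simp: c_def)
  have a: "a = real DIM(real ^ 'n) / 2 + 1 + s"
    by (simp add: a_def)
  show "smooth (frac_heat_right s \<phi>)"
    unfolding eq by (rule smooth_heat_integral[OF assms(1,2) a assms(3)])
  obtain C where C: "0 \<le> C" "\<And>X. norm (heat_integral a \<phi> X) \<le> C * parabolic_weight X powr (- a)"
    using heat_integral_decay[OF assms(1,2) a assms(3)] by blast
  \<comment> \<open>The 3 counts the terms of the denominator, each at most \<open>W powr a\<close>;
    the added 1 keeps the constant positive even if \<open>C\<close> is 0.\<close>
  define C' where "C' = 3 * (\<bar>c\<bar> * C + 1)"
  have "norm (frac_heat_right s \<phi> (x, t)) \<le> C' / (1 + norm x powr (real CARD('n) + 2 + 2 * s)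
                  + \<bar>t\<bar> powr (real CARD('n) / 2 + 1 + s))" for x t
  proof -
    define W where "W = parabolic_weight (x, t)"
    have W: "1 \<le> W" "(norm x)\<^sup>2 \<le> W" "\<bar>t\<bar> \<le> W"
      by (simp_all add: W_def parabolic_weight_def)
    have a0: "0 \<le> a" using assms by (simp add: a_def)
    \<comment> \<open>The spatial exponent n + 2 + 2s is 2a, that is, a applied to |x|^2.\<close>
    have "norm x powr (real CARD('n) + 2 + 2 * s) = ((norm x)\<^sup>2) powr a"
      by (simp add: powr_powr a_def algebra_simps flip: powr_numeral)
    also have "\<dots> \<le> W powr a"
      using W a0 by (intro powr_mono2) auto
    finally have 1: "norm x powr (real CARD('n) + 2 + 2 * s) \<le> W powr a" .
    have 2: "\<bar>t\<bar> powr a \<le> W powr a"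
      using W a0 by (intro powr_mono2) auto
    have 3: "1 \<le> W powr a"
      using W(1) a0 by (rule ge_one_powr_ge_zero)
    let ?D = "1 + norm x powr (real CARD('n) + 2 + 2 * s) + \<bar>t\<bar> powr a"
    have D: "0 < ?D"
      by (intro add_pos_nonneg) auto
    have D_le: "?D \<le> 3 * W powr a"
      using 1 2 3 by linarith
    have "norm (frac_heat_right s \<phi> (x, t)) \<le> \<bar>c\<bar> * (C * W powr (- a))"
      unfolding eq norm_scaleR W_def using C(2) by (intro mult_left_mono) auto
    also have "\<dots> = (\<bar>c\<bar> * C) / W powr a"
      by (simp add: powr_minus_divide)
    also have "\<dots> \<le> (\<bar>c\<bar> * C + 1) / W powr a"
      by (intro divide_right_mono) auto
    also have "\<dots> = C' / (3 * W powr a)"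
      unfolding C'_def by (rule mult_divide_mult_cancel_left[symmetric]) simp
    also have "\<dots> \<le> C' / ?D"
      using D D_le C(1) W(1) by (intro divide_left_mono mult_pos_pos) (auto simp: C'_def)
    finally show ?thesis by (simp add: a_def)
  qed
  moreover have "0 < C'"
    using C(1) by (simp add: C'_def add_nonneg_pos)
  ultimately show "\<exists>C>0. \<forall>(x :: real ^ 'n) (t :: real).
       norm (frac_heat_right s \<phi> (x, t))
         \<le> C / (1 + norm x powr (real CARD('n) + 2 + 2 * s)
                  + \<bar>t\<bar> powr (real CARD('n) / 2 + 1 + s))"
    by blast
qed

end
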